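(* Let $X$ be a homogeneous polynomial vector field of degree $2$ on $\mathbb S^2$. If $X$ has at least one non-hyperbolic singularity on $\mathbb S^2$ different from a weak focus, then $X$ has no limit cycles on $\mathbb S^2$.
   Context: $\mathbb S^2=\{(x,y,z)\in\mathbb R^3: x^2+y^2+z^2=1\}$. A homogeneous polynomial vector field of degree $n$ on $\mathbb S^2$ is a vector field $X=(P,Q,R)$ on $\mathbb R^3$ whose components are real homogeneous polynomials of degree $n$ with $xP+yQ+zR=0$ at all points of $\mathbb S^2$; thus it is tangent to $\mathbb S^2$, and one studies its flow restricted to $\mathbb S^2$. For a singularity $p\in\mathbb S^2$ consider the linear part $L_p$ at $p$ of $X$ restricted to $\mathbb S^2$ (a linear endomorphism of $T_p\mathbb S^2$). The singularity $p$ is hyperbolic if both eigenvalues of $L_p$ have nonzero real part, and non-hyperbolic otherwise. The singularity $p$ is a center if it has a neighbourhood $U$ in $\mathbb S^2$ with $U\setminus\{p\}$ filled by periodic orbits; it is a weak focus if $\operatorname{tr}L_p=0$, $\det L_p>0$ and $p$ is not a center. A limit cycle is a periodic orbit that is isolated in the set of all periodic orbits of $X$ on $\mathbb S^2$. *)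

theory Defs
  imports "HOL-Analysis.Analysis"
begin

abbreviation S2 :: "(real^3) set" where
  "S2 \<equiv> sphere 0 1"

text \<open>
  Polynomials are represented by the functions they induce, which over the reals loses nothing.
  The exponent of the third variable is determined by the other two.
  The zero polynomial counts as homogeneous of every degree.
\<close>

definition homogeneous_polynomial :: "nat \<Rightarrow> (real^3 \<Rightarrow> real) \<Rightarrow> bool" where
  "homogeneous_polynomial n f \<longleftrightarrow>
    (\<exists>c :: nat \<Rightarrow> nat \<Rightarrow> real. \<forall>v.
      f v = (\<Sum>i\<le>n. \<Sum>j\<le>n - i. c i j * v$1 ^ i * v$2 ^ j * v$3 ^ (n - i - j)))"

definition homogeneous_vf_on_S2 :: "nat \<Rightarrow> (real^3 \<Rightarrow> real^3) \<Rightarrow> bool" where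
  "homogeneous_vf_on_S2 n X \<longleftrightarrow>
    (\<forall>i. homogeneous_polynomial n (\<lambda>v. X v $ i)) \<and> (\<forall>v\<in>S2. v \<bullet> X v = 0)"

definition periodic_orbit :: "(real^3 \<Rightarrow> real^3) \<Rightarrow> (real^3) set \<Rightarrow> bool" where
  "periodic_orbit X C \<longleftrightarrow>
    (\<exists>\<gamma> T. (\<forall>t. \<gamma> t \<in> S2) \<and>
           (\<forall>t. (\<gamma> has_vector_derivative X (\<gamma> t)) (at t)) \<and>
           T > 0 \<and> (\<forall>t. \<gamma> (t + T) = \<gamma> t) \<and>
           \<not> \<gamma> constant_on UNIV \<and>
           C = range \<gamma>)"

text \<open>
  Isolation: some neighbourhood of the orbit in the sphere contains no other periodic orbit as a
  subset. Orbits that merely meet the neighbourhood are not excluded.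
\<close>

definition limit_cycle :: "(real^3 \<Rightarrow> real^3) \<Rightarrow> (real^3) set \<Rightarrow> bool" where
  "limit_cycle X C \<longleftrightarrow> periodic_orbit X C \<and>
    (\<exists>U. openin (top_of_set S2) U \<and> C \<subseteq> U \<and>
         (\<forall>C'. periodic_orbit X C' \<and> C' \<subseteq> U \<longrightarrow> C' = C))"

definition singularity :: "(real^3 \<Rightarrow> real^3) \<Rightarrow> real^3 \<Rightarrow> bool" where
  "singularity X p \<longleftrightarrow> p \<in> S2 \<and> X p = 0"

definition tangent_space :: "real^3 \<Rightarrow> (real^3) set" where
  "tangent_space p = {v. p \<bullet> v = 0}"

definition orthonormal_frame :: "real^3 \<Rightarrow> real^3^2 \<Rightarrow> bool" where
  "orthonormal_frame p e \<longleftrightarrow>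
    (\<forall>i. e$i \<in> tangent_space p) \<and> (\<forall>i j. e$i \<bullet> e$j = (if i = j then 1 else 0))"

definition frame_matrix :: "real^3^2 \<Rightarrow> (real^3 \<Rightarrow> real^3) \<Rightarrow> real^2^2" where
  "frame_matrix e L = (\<chi> i j. e$i \<bullet> L (e$j))"

text \<open>
  At a singularity \<open>p\<close> the derivative of the ambient field maps the tangent space at \<open>p\<close> to itself
  (lemma \<open>derivative_tangent\<close> below), and its restriction there is the linear part at \<open>p\<close> of the
  field restricted to the sphere. The matrix of the linear part depends on the chosen frame only up
  to orthogonal similarity (lemma \<open>frame_matrix_similar\<close> below).
\<close>

definition linear_part_matrix :: "(real^3 \<Rightarrow> real^3) \<Rightarrow> real^3 \<Rightarrow> real^2^2" where
  "linear_part_matrix X p =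
    frame_matrix (SOME e. orthonormal_frame p e) (frechet_derivative X (at p))"

definition complex_eigenvalue :: "real^2^2 \<Rightarrow> complex \<Rightarrow> bool" where
  "complex_eigenvalue A \<mu> \<longleftrightarrow>
    (\<exists>w :: complex^2. w \<noteq> 0 \<and> map_matrix complex_of_real A *v w = \<mu> *s w)"

definition hyperbolic :: "(real^3 \<Rightarrow> real^3) \<Rightarrow> real^3 \<Rightarrow> bool" where
  "hyperbolic X p \<longleftrightarrow> singularity X p \<and>
    (\<forall>\<mu>. complex_eigenvalue (linear_part_matrix X p) \<mu> \<longrightarrow> Re \<mu> \<noteq> 0)"

definition center :: "(real^3 \<Rightarrow> real^3) \<Rightarrow> real^3 \<Rightarrow> bool" where
  "center X p \<longleftrightarrow> singularity X p \<and>
    (\<exists>U. openin (top_of_set S2) U \<and> p \<in> U \<and>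
         (\<forall>q \<in> U - {p}. \<exists>C. periodic_orbit X C \<and> q \<in> C \<and> C \<subseteq> U - {p}))"

definition weak_focus :: "(real^3 \<Rightarrow> real^3) \<Rightarrow> real^3 \<Rightarrow> bool" where
  "weak_focus X p \<longleftrightarrow> singularity X p \<and>
    trace (linear_part_matrix X p) = 0 \<and> det (linear_part_matrix X p) > 0 \<and> \<not> center X p"

lemma orthonormal_frame_exists:
  assumes "p \<in> S2"
  shows "\<exists>e. orthonormal_frame p e"
proof -
  have p: "p \<noteq> 0" using assms by auto
  obtain B where B: "B \<subseteq> {v. p \<bullet> v = 0}" "pairwise orthogonal B" "\<And>x. x \<in> B \<Longrightarrow> norm x = 1"
      "card B = dim {v. p \<bullet> v = 0}"
    using orthonormal_basis_subspace[OF subspace_hyperplane[of p]] by metis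
  have "card B = 2" using B(4) dim_hyperplane[OF p] by simp
  then obtain u w where uw: "B = {u, w}" "u \<noteq> w" by (meson card_2_iff)
  define e :: "real^3^2" where "e = vector [u, w]"
  have "u \<bullet> w = 0" using B(2) uw by (simp add: pairwise_def orthogonal_def)
  moreover have "u \<bullet> u = 1" "w \<bullet> w = 1" using B(3) uw by (auto simp: norm_eq_1)
  moreover have "p \<bullet> u = 0" "p \<bullet> w = 0" using B(1) uw by auto
  ultimately have "orthonormal_frame p e"
    by (simp add: orthonormal_frame_def forall_2 e_def tangent_space_def inner_commute)
  then show ?thesis ..
qed

lemma orthonormal_frame_expand:
  assumes "p \<in> S2" "orthonormal_frame p e" "x \<in> tangent_space p"
  shows "x = (\<Sum>i\<in>UNIV. (e$i \<bullet> x) *\<^sub>R e$i)"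
proof (rule ccontr)
  assume neq: "\<not> ?thesis"
  define y where "y = x - (\<Sum>i\<in>UNIV. (e$i \<bullet> x) *\<^sub>R e$i)"
  have y0: "y \<noteq> 0" using neq by (simp add: y_def)
  have ee: "e$1 \<bullet> e$1 = 1" "e$2 \<bullet> e$2 = 1" "e$1 \<bullet> e$2 = 0" "e$2 \<bullet> e$1 = 0"
    using assms(2) by (auto simp: orthonormal_frame_def)
  have pe: "p \<bullet> e$1 = 0" "p \<bullet> e$2 = 0" "p \<bullet> x = 0"
    using assms by (auto simp: orthonormal_frame_def tangent_space_def)
  have pp: "p \<bullet> p = 1" using assms(1) by (simp add: norm_eq_1)
  have y: "y \<bullet> e$1 = 0" "y \<bullet> e$2 = 0" "y \<bullet> p = 0"
    using ee pe
    by (simp_all add: y_def sum_2 inner_diff_left inner_diff_right inner_add_left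
        inner_add_right inner_commute[of _ p] inner_commute[of x])
  have ne: "p \<noteq> 0" "e$1 \<noteq> 0" "e$2 \<noteq> 0" using pp ee by auto
  let ?S = "{p, e$1, e$2, y}"
  have dist: "p \<noteq> e$1" "p \<noteq> e$2" "p \<noteq> y" "e$1 \<noteq> e$2" "e$1 \<noteq> y" "e$2 \<noteq> y"
    using pe y pp ee by auto
  have "pairwise orthogonal ?S"
    using ee pe y by (auto simp: pairwise_def orthogonal_def inner_commute)
  moreover have "0 \<notin> ?S" using ne y0 by auto
  ultimately have "independent ?S" by (rule pairwise_orthogonal_independent)
  then have "card ?S \<le> 3" using independent_bound[of ?S] by simp
  then show False using dist by simp
qed

lemma frame_matrix_similar:
  assumes "p \<in> S2" "orthonormal_frame p e" "orthonormal_frame p f" "linear L"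
  shows "\<exists>Q. orthogonal_matrix Q \<and> frame_matrix f L = transpose Q ** frame_matrix e L ** Q"
proof (intro exI conjI)
  let ?Q = "(\<chi> i j. e$i \<bullet> f$j) :: real^2^2"
  have f: "f$j = (\<Sum>i\<in>UNIV. ?Q$i$j *\<^sub>R e$i)" for j
    using orthonormal_frame_expand[OF assms(1,2), of "f$j"] assms(3)
    by (simp add: orthonormal_frame_def)
  have ee: "e$i \<bullet> e$j = (if i = j then 1 else 0)" "f$i \<bullet> f$j = (if i = j then 1 else 0)" for i j
    using assms(2,3) by (auto simp: orthonormal_frame_def)
  have "(transpose ?Q ** ?Q) $ i $ j = (mat 1 :: real^2^2) $ i $ j" for i j
  proof -
    have "(transpose ?Q ** ?Q) $ i $ j = (\<Sum>k\<in>UNIV. ?Q$k$i * (e$k \<bullet> f$j))"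
      by (simp add: matrix_matrix_mult_def transpose_def)
    also have "\<dots> = (\<Sum>k\<in>UNIV. ?Q$k$i *\<^sub>R e$k) \<bullet> f$j"
      by (simp add: inner_sum_left)
    also have "\<dots> = f$i \<bullet> f$j" by (simp only: f[symmetric])
    finally show ?thesis by (simp add: ee mat_def)
  qed
  then show "orthogonal_matrix ?Q"
    by (simp add: orthogonal_matrix vec_eq_iff)
  have "frame_matrix f L $ i $ j = (transpose ?Q ** frame_matrix e L ** ?Q) $ i $ j" for i j
  proof -
    have "frame_matrix f L $ i $ j
        = (\<Sum>k\<in>UNIV. ?Q$k$i *\<^sub>R e$k) \<bullet> L (\<Sum>l\<in>UNIV. ?Q$l$j *\<^sub>R e$l)"
      unfolding frame_matrix_def f[symmetric] by (simp only: vec_lambda_beta)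
    also have "\<dots> = (transpose ?Q ** frame_matrix e L ** ?Q) $ i $ j"
      by (simp add: sum_2 linear_add[OF assms(4)] linear_scale[OF assms(4)] inner_add_left
          inner_add_right matrix_matrix_mult_def transpose_def frame_matrix_def algebra_simps)
    finally show ?thesis .
  qed
  then show "frame_matrix f L = transpose ?Q ** frame_matrix e L ** ?Q"
    by (simp add: vec_eq_iff)
qed

lemma homogeneous_polynomial_differentiable:
  assumes "homogeneous_polynomial n f"
  shows "f differentiable (at p)"
proof -
  obtain c where "f = (\<lambda>v. \<Sum>i\<le>n. \<Sum>j\<le>n - i. c i j * v$1 ^ i * v$2 ^ j * v$3 ^ (n - i - j))"
    using assms by (auto simp: homogeneous_polynomial_def)
  moreover have "(\<lambda>v::real^3. v $ k) differentiable (at p)" for k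
    by (rule bounded_linear_imp_differentiable) (rule bounded_linear_vec_nth)
  ultimately show ?thesis
    by (auto intro!: differentiable_sum differentiable_mult differentiable_power)
qed

lemma homogeneous_polynomial_scale:
  assumes "homogeneous_polynomial n f"
  shows "f (a *\<^sub>R v) = a ^ n * f v"
proof -
  obtain c where f: "\<And>v. f v = (\<Sum>i\<le>n. \<Sum>j\<le>n - i. c i j * v$1 ^ i * v$2 ^ j * v$3 ^ (n - i - j))"
    using assms by (auto simp: homogeneous_polynomial_def)
  have "a ^ i * (a ^ j * a ^ (n - i - j)) = a ^ n" if "i \<le> n" "j \<le> n - i" for i j
    using that by (simp flip: power_add)
  then show ?thesis
    unfolding f sum_distrib_left by (intro sum.cong refl) (simp add: power_mult_distrib)
qed

lemma homogeneous_vf_differentiable: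
  assumes "homogeneous_vf_on_S2 n X"
  shows "X differentiable (at p)"
proof -
  have "(\<lambda>v. X v \<bullet> b) differentiable (at p)" if "b \<in> Basis" for b
  proof -
    obtain i where "b = axis i 1" using \<open>b \<in> Basis\<close> by (auto simp: Basis_vec_def)
    then show ?thesis
      using assms homogeneous_polynomial_differentiable[of n "\<lambda>v. X v $ i"]
      by (simp add: homogeneous_vf_on_S2_def inner_axis)
  qed
  then show ?thesis using differentiable_componentwise_within[of X p UNIV] by simp
qed

lemma derivative_tangent:
  assumes X: "homogeneous_vf_on_S2 n X" and p: "singularity X p"
  shows "frechet_derivative X (at p) v \<in> tangent_space p"
proof -
  have scale: "X (a *\<^sub>R v) = a ^ n *\<^sub>R X v" for a v
    using X homogeneous_polynomial_scale[of n "\<lambda>v. X v $ i" for i]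
    by (simp add: vec_eq_iff homogeneous_vf_on_S2_def)
  have "v \<bullet> X v = 0" for v
  proof (cases "v = 0")
    case False
    then have "sgn v \<in> S2" by (simp add: norm_sgn)
    then have "sgn v \<bullet> X (sgn v) = 0" using X by (simp add: homogeneous_vf_on_S2_def)
    then show ?thesis using False by (simp add: sgn_div_norm scale)
  qed simp
  then have "((\<lambda>v. v \<bullet> X v) has_derivative (\<lambda>_. 0)) (at p)" by simp
  moreover have "(X has_derivative frechet_derivative X (at p)) (at p)"
    using homogeneous_vf_differentiable[OF X] frechet_derivative_works by blast
  then have "((\<lambda>v. v \<bullet> X v) has_derivative
      (\<lambda>v. p \<bullet> frechet_derivative X (at p) v + v \<bullet> X p)) (at p)"
    by (auto intro!: derivative_eq_intros)
  ultimately have "(\<lambda>v. p \<bullet> frechet_derivative X (at p) v + v \<bullet> X p) = (\<lambda>_. 0)"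
    using has_derivative_unique by blast
  then show ?thesis
    using p by (auto simp: fun_eq_iff tangent_space_def singularity_def)
qed

end

theory Submission
  imports Defs
begin

text \<open>
  A quadratic field tangent to the sphere has the form \<open>X v = v \<times> M v\<close> for a \<open>3 \<times> 3\<close> matrix \<open>M\<close>, so its
  singularities are the unit eigenvectors of \<open>M\<close>. Let \<open>p\<close> be a non-hyperbolic singularity that is not
  a weak focus, \<open>M p = \<kappa> p\<close>, and let \<open>N\<close> be the compression of \<open>M - \<kappa>\<close> to \<open>p\<^sup>\<bottom>\<close>; the linear part at \<open>p\<close> is
  \<open>N\<close> followed by a quarter turn. Either \<open>N\<close> is singular, or \<open>N\<close> is symmetric and \<open>p\<close> is a center.

  In the first case there is a linear function that is monotone along the flow, unless \<open>M - \<kappa>\<close> has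
  rank one. In the second case a local Lyapunov function shows that a center forces \<open>M\<close> to have a
  vector \<open>k\<close> that is both a left and a right eigenvector; rank-one \<open>M - \<kappa>\<close> has one as well. Such a \<open>k\<close>
  makes the flow reversible under the reflection in \<open>k\<^sup>\<bottom>\<close>. A periodic orbit meeting this plane is
  surrounded by periodic orbits, and off the plane the flow is a linear planar system up to a change
  of time, which is handled by monotone functions.
\<close>

subsection \<open>Global solutions of Lipschitz differential equations\<close>

text \<open>Being a center is a qualitative property and has to be turned into algebra on
  \<open>M\<close>. In principal axes of the symmetric \<open>N\<close> both axis vectors are left
  eigenvectors of \<open>M\<close>, with eigenvalues \<open>a + \<kappa>\<close> and
  \<open>d + \<kappa>\<close>; only the entries \<open>e\<close> and \<open>g\<close> in the row of
  \<open>p\<close> keep them from being right eigenvectors. A common eigenvector exists as soon as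
  \<open>e\<close>, \<open>g\<close> or \<open>a - d\<close> vanishes, so the product
  \<open>(a - d) * e * g\<close> is the whole obstruction. If it is nonzero, \<open>p\<close>
  strictly attracts or repels and cannot be a center.

  Neither return maps nor Poincare-Bendixson theory enter. A function that is monotone along a
  periodic solution is constant on it, which forces a singular point onto the orbit. Periodic orbits
  across the mirror plane may well exist, so for these only isolation can be refuted. That requires
  nearby solutions, defined for all times and depending continuously on the starting point.\<close>

lemma has_vector_derivative_affine_arg:
  assumes "(f has_vector_derivative f') (at (c + a * t))"
  shows "((\<lambda>t. f (c + a * t)) has_vector_derivative a *\<^sub>R f') (at t)"
proof -
  have "((\<lambda>t. c + a * t) has_vector_derivative a) (at t)"
    unfolding has_real_derivative_iff_has_vector_derivative[symmetric]
    by (auto intro!: derivative_eq_intros)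
  from vector_diff_chain_at[OF this assms] show ?thesis by (simp add: o_def)
qed

lemma primitive_on_reals:
  fixes g :: "real \<Rightarrow> 'a::banach"
  assumes "continuous_on UNIV g"
  obtains G where "G 0 = 0" "\<And>t. (G has_vector_derivative g t) (at t)"
proof -
  define G where "G t = (if t \<ge> 0 then integral {0..t} g else - integral {t..0} g)" for t
  have cont: "continuous_on {a..b} g" for a b
    using assms continuous_on_subset by blast
  have "(G has_vector_derivative g t) (at t)" for t
  proof -
    define b where "b = \<bar>t\<bar> + 1"
    \<comment> \<open>Moving the base point to \<open>-b\<close> turns both branches of
      \<open>G\<close> into one integral up to a constant, so time 0 needs no separate
      treatment.\<close>
    have G: "G s = integral {-b..s} g - integral {-b..0} g" if "s \<in> {-b<..<b}" for s
    proof (cases "s \<ge> 0")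
      case True
      then show ?thesis
        using Henstock_Kurzweil_Integration.integral_combine[where a="-b" and c=0 and b=s and f=g] that integrable_continuous_real[OF cont]
        by (simp add: G_def b_def algebra_simps)
    next
      case False
      then show ?thesis
        using Henstock_Kurzweil_Integration.integral_combine[where a="-b" and c=s and b=0 and f=g] that integrable_continuous_real[OF cont]
        by (simp add: G_def b_def algebra_simps)
    qed
    have "((\<lambda>s. integral {-b..s} g) has_vector_derivative g t) (at t within {-b..b})"
      by (rule integral_has_vector_derivative[OF cont]) (auto simp: b_def)
    moreover have "at t within {-b..b} = at t"
      by (rule at_within_Icc_at) (auto simp: b_def)
    ultimately have "((\<lambda>s. integral {-b..s} g - integral {-b..0} g) has_vector_derivative g t) (at t)"
      by (auto intro!: derivative_eq_intros)
    then show ?thesis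
      by (rule has_vector_derivative_transform_within_open[of _ _ _ "{-b<..<b}"])
        (auto simp: G b_def)
  qed
  moreover have "G 0 = 0" by (simp add: G_def)
  ultimately show ?thesis using that by blast
qed

text \<open>Integration against the weight \<open>exp (K * \<bar>t\<bar>)\<close> gains the factor
  \<open>1 / K\<close>; this gain makes the Picard operator contract for large \<open>K\<close>.
  Negative times reduce to positive ones by reflecting \<open>G\<close>.\<close>

lemma primitive_exp_bound:
  fixes G :: "real \<Rightarrow> 'a::real_normed_vector"
  assumes K: "K > 0" and G0: "G 0 = 0" and G: "\<And>t. (G has_vector_derivative g t) (at t)"
    and g: "\<And>t. norm (g t) \<le> B * exp (K * \<bar>t\<bar>)"
  shows "norm (G t) \<le> B / K * exp (K * \<bar>t\<bar>)"
proof -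
  have B: "B \<ge> 0" using order_trans[OF norm_ge_zero g[of 0]] by simp
  have pos: "norm (H t) \<le> B / K * exp (K * t)"
    if "t > 0" "H 0 = 0" and H: "\<And>t. (H has_vector_derivative h t) (at t)"
      and h: "\<And>t. norm (h t) \<le> B * exp (K * \<bar>t\<bar>)" for t H and h :: "real \<Rightarrow> 'a"
  proof -
    have "norm (H t - H 0) \<le> B / K * exp (K * t) - B / K * exp (K * 0)"
    proof (rule differentiable_bound_general[OF \<open>t > 0\<close>])
      show "continuous_on {0..t} H"
        using H by (meson has_vector_derivative_continuous continuous_at_imp_continuous_on)
      show "((\<lambda>x. B / K * exp (K * x)) has_vector_derivative B * exp (K * x)) (at x)" for x
        unfolding has_real_derivative_iff_has_vector_derivative[symmetric]
        using \<open>K > 0\<close> by (auto intro!: derivative_eq_intros)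
      show "norm (h x) \<le> B * exp (K * x)" if "0 < x" for x
        using h[of x] that by simp
    qed (use K in \<open>auto intro!: continuous_intros H\<close>)
    moreover have "0 \<le> B / K" using B \<open>K > 0\<close> by simp
    ultimately show ?thesis using \<open>H 0 = 0\<close> by simp
  qed
  consider "t = 0" | "t > 0" | "t < 0" by linarith
  then show ?thesis
  proof cases
    case 1
    then show ?thesis using G0 B \<open>K > 0\<close> by simp
  next
    case 2
    then show ?thesis using pos[OF 2 G0 G g] by simp
  next
    case 3
    have "((\<lambda>t. G (- t)) has_vector_derivative - g (- t)) (at t)" for t
      using has_vector_derivative_affine_arg[of G "g (- t)" 0 "-1" t] G[of "- t"] by simp
    then show ?thesis
      using pos[of "-t" "\<lambda>t. G (- t)" "\<lambda>t. - g (- t)"] 3 G0 g[of "- t" for t] by simp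
  qed
qed

text \<open>
  Picard iteration becomes a contraction on bounded continuous \<open>u\<close> once solutions are written as
  \<open>q + exp (K \<bar>t\<bar>) u t\<close> with \<open>K\<close> larger than the Lipschitz constant; this gives the whole line at once.
\<close>

theorem global_lipschitz_solution:
  fixes f :: "'a::banach \<Rightarrow> 'a"
  assumes lip: "\<And>x y. norm (f x - f y) \<le> L * norm (x - y)"
  obtains \<gamma> where "\<gamma> 0 = q" "\<And>t. (\<gamma> has_vector_derivative f (\<gamma> t)) (at t)"
proof -
  \<comment> \<open>The contraction factor is \<open>\<bar>L\<bar> / K\<close>, at most 1/2 for this
    \<open>K\<close>; the added 1 keeps \<open>K\<close> positive when \<open>L = 0\<close>.\<close>
  define K where "K = 2 * \<bar>L\<bar> + 1"
  have K: "K > 0" by (simp add: K_def)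
  have lip': "norm (f x - f y) \<le> \<bar>L\<bar> * norm (x - y)" for x y
    by (rule order_trans[OF lip]) (simp add: mult_right_mono)
  have contf: "continuous_on UNIV f"
    by (rule lipschitz_on_continuous_on[of "\<bar>L\<bar>"]) (simp add: lipschitz_on_def dist_norm lip')
  define w where "w u s = f (q + exp (K * \<bar>s\<bar>) *\<^sub>R apply_bcontfun u s)" for u s
  have contw: "continuous_on UNIV (w u)" for u
    unfolding w_def
    by (rule continuous_on_compose2[OF contf]) (auto intro!: continuous_intros)
  have "\<exists>G. G 0 = 0 \<and> (\<forall>t. (G has_vector_derivative w u t) (at t))" for u
    using primitive_on_reals[OF contw] by metis
  then obtain G where G0: "\<And>u. G u 0 = 0"
    and G: "\<And>u t. (G u has_vector_derivative w u t) (at t)" by metis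
  have Gcont: "continuous_on UNIV (G u)" for u
    using G by (meson has_vector_derivative_continuous continuous_at_imp_continuous_on)
  have Gdiff: "norm (G u t - G v t) \<le> \<bar>L\<bar> * dist u v / K * exp (K * \<bar>t\<bar>)" for u v t
  proof (rule primitive_exp_bound[OF K])
    show "((\<lambda>t. G u t - G v t) has_vector_derivative w u t - w v t) (at t)" for t
      by (intro derivative_intros G)
    fix s
    have "norm (w u s - w v s) \<le> \<bar>L\<bar> * (exp (K * \<bar>s\<bar>) * dist (apply_bcontfun u s) (apply_bcontfun v s))"
      unfolding w_def
      by (rule order_trans[OF lip']) (simp add: dist_norm flip: scaleR_diff_right)
    also have "\<dots> \<le> \<bar>L\<bar> * (exp (K * \<bar>s\<bar>) * dist u v)"
      by (intro mult_left_mono dist_bounded) auto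
    finally show "norm (w u s - w v s) \<le> \<bar>L\<bar> * dist u v * exp (K * \<bar>s\<bar>)" by (simp add: mult_ac)
  qed (simp add: G0)
  \<comment> \<open>Boundedness of the Picard image comes from comparison with the zero function,
    whose integrand is the constant \<open>f q\<close>.\<close>
  define z :: "real \<Rightarrow>\<^sub>C 'a" where "z = const_bcontfun 0"
  have z: "apply_bcontfun z s = 0" for s by (simp add: z_def const_bcontfun.rep_eq)
  have Gz: "norm (G z t) \<le> norm (f q) / K * exp (K * \<bar>t\<bar>)" for t
    by (rule primitive_exp_bound[OF K G0 G]) (use K in \<open>simp add: w_def z mult_le_cancel_left1\<close>)
  define P where "P u = Bcontfun (\<lambda>t. exp (- (K * \<bar>t\<bar>)) *\<^sub>R G u t)" for u
  have "(\<lambda>t. exp (- (K * \<bar>t\<bar>)) *\<^sub>R G u t) \<in> bcontfun" for u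
    unfolding bcontfun_def
  proof safe
    show "continuous_on UNIV (\<lambda>t. exp (- (K * \<bar>t\<bar>)) *\<^sub>R G u t)"
      by (intro continuous_intros Gcont)
    have "norm (exp (- (K * \<bar>t\<bar>)) *\<^sub>R G u t) \<le> norm (f q) / K + \<bar>L\<bar> * dist u z / K" for t
    proof -
      have "norm (G u t) \<le> norm (G z t) + norm (G u t - G z t)" by norm
      also have "\<dots> \<le> (norm (f q) / K + \<bar>L\<bar> * dist u z / K) * exp (K * \<bar>t\<bar>)"
        using Gdiff[of u t z] Gz[of t] by (simp add: algebra_simps)
      finally show ?thesis by (simp add: exp_minus field_simps)
    qed
    then show "bounded (range (\<lambda>t. exp (- (K * \<bar>t\<bar>)) *\<^sub>R G u t))"
      by (intro boundedI) auto
  qed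
  then have P: "apply_bcontfun (P u) = (\<lambda>t. exp (- (K * \<bar>t\<bar>)) *\<^sub>R G u t)" for u
    unfolding P_def by (rule Bcontfun_inverse)
  have "dist (P u) (P v) \<le> 1/2 * dist u v" for u v
  proof (rule dist_bound)
    fix t
    have "dist (apply_bcontfun (P u) t) (apply_bcontfun (P v) t) = exp (- (K * \<bar>t\<bar>)) * norm (G u t - G v t)"
      by (simp add: P dist_norm flip: scaleR_diff_right)
    also have "\<dots> \<le> exp (- (K * \<bar>t\<bar>)) * (\<bar>L\<bar> * dist u v / K * exp (K * \<bar>t\<bar>))"
      by (intro mult_left_mono Gdiff) auto
    also have "\<dots> = \<bar>L\<bar> / K * dist u v" by (simp add: exp_minus field_simps)
    also have "\<dots> \<le> 1/2 * dist u v"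
      by (intro mult_right_mono) (auto simp: K_def field_simps)
    finally show "dist (apply_bcontfun (P u) t) (apply_bcontfun (P v) t) \<le> 1/2 * dist u v" .
  qed
  then obtain u where u: "P u = u"
    using banach_fix_type[of "1/2" P] by auto
  define \<gamma> where "\<gamma> t = q + exp (K * \<bar>t\<bar>) *\<^sub>R apply_bcontfun u t" for t
  have \<gamma>: "\<gamma> = (\<lambda>t. q + G u t)"
    using fun_cong[OF P[of u]] by (simp add: u \<gamma>_def fun_eq_iff exp_minus)
  have "(\<gamma> has_vector_derivative f (\<gamma> t)) (at t)" for t
  proof -
    have "w u t = f (\<gamma> t)" by (simp add: w_def \<gamma>_def)
    with G[of u t] show ?thesis unfolding \<gamma> by (auto intro!: derivative_eq_intros)
  qed
  moreover have "\<gamma> 0 = q" by (simp add: \<gamma> G0)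
  ultimately show ?thesis using that by blast
qed

text \<open>The squared distance times \<open>exp (- 2 * L * t)\<close> has nonpositive derivative
  by Cauchy-Schwarz; squaring avoids differentiating the norm at 0. The Lipschitz bound is asked
  only on a set containing both solutions, because quadratic fields are in general not globally
  Lipschitz.\<close>

lemma gronwall_forward:
  fixes f :: "'a::real_inner \<Rightarrow> 'a"
  assumes lip: "\<And>x y. x \<in> S \<Longrightarrow> y \<in> S \<Longrightarrow> norm (f x - f y) \<le> L * norm (x - y)"
    and \<gamma>: "\<And>t. \<gamma> t \<in> S" "\<And>t. (\<gamma> has_vector_derivative f (\<gamma> t)) (at t)"
    and \<eta>: "\<And>t. \<eta> t \<in> S" "\<And>t. (\<eta> has_vector_derivative f (\<eta> t)) (at t)"
    and "s \<le> t"
  shows "norm (\<gamma> t - \<eta> t) \<le> exp (L * (t - s)) * norm (\<gamma> s - \<eta> s)"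
proof -
  define \<rho> where "\<rho> t = exp (- 2 * L * t) * ((\<gamma> t - \<eta> t) \<bullet> (\<gamma> t - \<eta> t))" for t
  define \<rho>' where "\<rho>' t = exp (- 2 * L * t) * (2 * ((\<gamma> t - \<eta> t) \<bullet> (f (\<gamma> t) - f (\<eta> t)))
    - 2 * L * ((\<gamma> t - \<eta> t) \<bullet> (\<gamma> t - \<eta> t)))" for t
  have "(\<rho> has_real_derivative \<rho>' t) (at t)" for t
  proof -
    have "((\<lambda>t. (\<gamma> t - \<eta> t) \<bullet> (\<gamma> t - \<eta> t)) has_vector_derivative
        (\<gamma> t - \<eta> t) \<bullet> (f (\<gamma> t) - f (\<eta> t)) + (f (\<gamma> t) - f (\<eta> t)) \<bullet> (\<gamma> t - \<eta> t)) (at t)"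
      by (intro bounded_bilinear.has_vector_derivative[OF bounded_bilinear_inner] derivative_intros \<gamma> \<eta>)
    then have "((\<lambda>t. (\<gamma> t - \<eta> t) \<bullet> (\<gamma> t - \<eta> t)) has_real_derivative
        2 * ((\<gamma> t - \<eta> t) \<bullet> (f (\<gamma> t) - f (\<eta> t)))) (at t)"
      by (simp add: has_real_derivative_iff_has_vector_derivative inner_commute)
    moreover have "((\<lambda>t. exp (- 2 * L * t)) has_real_derivative exp (- 2 * L * t) * (- 2 * L)) (at t)"
      by (auto intro!: derivative_eq_intros)
    ultimately show ?thesis
      unfolding \<rho>_def \<rho>'_def
      by - (rule DERIV_mult[THEN DERIV_cong], assumption+, simp add: algebra_simps)
  qed
  moreover have "\<rho>' t \<le> 0" for t
  proof -
    have "(\<gamma> t - \<eta> t) \<bullet> (f (\<gamma> t) - f (\<eta> t)) \<le> norm (\<gamma> t - \<eta> t) * norm (f (\<gamma> t) - f (\<eta> t))"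
      by (rule norm_cauchy_schwarz)
    also have "\<dots> \<le> norm (\<gamma> t - \<eta> t) * (L * norm (\<gamma> t - \<eta> t))"
      by (intro mult_left_mono lip \<gamma> \<eta>) auto
    also have "\<dots> = L * ((\<gamma> t - \<eta> t) \<bullet> (\<gamma> t - \<eta> t))"
      by (simp add: power2_norm_eq_inner[symmetric] power2_eq_square)
    finally show ?thesis by (simp add: \<rho>'_def mult_le_0_iff)
  qed
  ultimately have "\<rho> t \<le> \<rho> s"
    using \<open>s \<le> t\<close> by (meson DERIV_nonpos_imp_nonincreasing)
  then have "exp (2 * L * t) * \<rho> t \<le> exp (2 * L * t) * \<rho> s" by simp
  moreover have "exp (2 * L * t) * \<rho> t = (norm (\<gamma> t - \<eta> t))\<^sup>2"
    by (simp add: \<rho>_def power2_norm_eq_inner exp_minus)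
  moreover have "exp (2 * L * t) * \<rho> s = (exp (L * (t - s)) * norm (\<gamma> s - \<eta> s))\<^sup>2"
  proof -
    have "exp (2 * L * t) * exp (- 2 * L * s) = (exp (L * (t - s)))\<^sup>2"
      unfolding exp_add[symmetric] exp_double[symmetric] by (simp add: algebra_simps)
    then show ?thesis
      by (simp add: \<rho>_def power_mult_distrib power2_norm_eq_inner flip: mult.assoc)
  qed
  ultimately have "(norm (\<gamma> t - \<eta> t))\<^sup>2 \<le> (exp (L * (t - s)) * norm (\<gamma> s - \<eta> s))\<^sup>2" by simp
  then show ?thesis by (rule power2_le_imp_le) simp
qed

lemma lipschitz_solution_unique:
  fixes f :: "'a::real_inner \<Rightarrow> 'a"
  assumes lip: "\<And>x y. x \<in> S \<Longrightarrow> y \<in> S \<Longrightarrow> norm (f x - f y) \<le> L * norm (x - y)"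
    and \<gamma>: "\<And>t. \<gamma> t \<in> S" "\<And>t. (\<gamma> has_vector_derivative f (\<gamma> t)) (at t)"
    and \<eta>: "\<And>t. \<eta> t \<in> S" "\<And>t. (\<eta> has_vector_derivative f (\<eta> t)) (at t)"
    and "\<gamma> s = \<eta> s"
  shows "\<gamma> t = \<eta> t"
proof (cases "s \<le> t")
  case True
  then show ?thesis
    using gronwall_forward[OF lip \<gamma> \<eta> True] \<open>\<gamma> s = \<eta> s\<close> by simp
next
  case False
  have rev: "((\<lambda>t. \<beta> (- t)) has_vector_derivative - f (\<beta> (- t))) (at t)"
    if "\<And>t. (\<beta> has_vector_derivative f (\<beta> t)) (at t)" for \<beta> t
    using has_vector_derivative_affine_arg[of \<beta> "f (\<beta> (- t))" 0 "-1" t] that[of "- t"] by simp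
  have "norm (\<gamma> (- (- t)) - \<eta> (- (- t))) \<le> exp (L * (- t - (- s))) * norm (\<gamma> (- (- s)) - \<eta> (- (- s)))"
    by (rule gronwall_forward[where f="\<lambda>x. - f x" and S=S])
      (use False lip \<gamma> \<eta> rev in \<open>auto simp: norm_minus_commute\<close>)
  then show ?thesis using \<open>\<gamma> s = \<eta> s\<close> by simp
qed

subsection \<open>Orbits on the sphere\<close>

text \<open>Composing \<open>X\<close> with the nearest-point retraction \<open>c\<close> onto the
  ball gives a globally Lipschitz field. As \<open>v\<close> is a multiple of \<open>c v\<close>,
  the new field is still orthogonal to \<open>v\<close>, so solutions keep their norm, stay on the
  sphere, and never notice the retraction.\<close>

lemma sphere_solution:
  fixes X :: "'a::euclidean_space \<Rightarrow> 'a"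
  assumes lip: "\<And>v w. v \<in> cball 0 1 \<Longrightarrow> w \<in> cball 0 1 \<Longrightarrow> norm (X v - X w) \<le> L * norm (v - w)"
    and tangent: "\<And>v. v \<in> cball 0 1 \<Longrightarrow> v \<bullet> X v = 0"
    and q: "q \<in> sphere 0 1"
  obtains \<gamma> where "\<gamma> 0 = q" "\<And>t. \<gamma> t \<in> sphere 0 1"
    "\<And>t. (\<gamma> has_vector_derivative X (\<gamma> t)) (at t)"
proof -
  define c :: "'a \<Rightarrow> 'a" where "c = closest_point (cball 0 1)"
  have c_in: "c v \<in> cball 0 1" for v
    unfolding c_def by (rule closest_point_in_set) auto
  have c_lip: "norm (c v - c w) \<le> norm (v - w)" for v w
    using closest_point_lipschitz[of "cball (0::'a) 1" v w] by (simp add: c_def dist_norm)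
  have c_scale: "\<exists>r. v = r *\<^sub>R c v" for v
  proof (cases "v \<in> cball 0 1")
    case True
    then have "v = 1 *\<^sub>R c v" by (simp add: c_def closest_point_self)
    then show ?thesis ..
  next
    case False
    then have "norm v > 1" "v \<noteq> 0" by auto
    have "closest_point (cball 0 1) v = (1 / norm v) *\<^sub>R v"
    proof (rule closest_point_unique[symmetric])
      have "dist v ((1 / norm v) *\<^sub>R v) \<le> dist v z" if "z \<in> cball 0 1" for z
      proof -
        have "dist v ((1 / norm v) *\<^sub>R v) = norm v - 1"
        proof -
          have "v - (1 / norm v) *\<^sub>R v = ((norm v - 1) / norm v) *\<^sub>R v"
            using \<open>v \<noteq> 0\<close> by (simp add: algebra_simps diff_divide_distrib)
          then show ?thesis using \<open>norm v > 1\<close> \<open>v \<noteq> 0\<close> by (simp add: dist_norm)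
        qed
        also have "\<dots> \<le> dist v z"
          using \<open>z \<in> cball 0 1\<close> norm_triangle_ineq2[of v z] by (simp add: dist_norm)
        finally show ?thesis .
      qed
      then show "\<forall>z\<in>cball 0 1. dist v ((1 / norm v) *\<^sub>R v) \<le> dist v z" by blast
    qed (use False in \<open>auto simp: zero_less_norm_iff\<close>)
    then have "v = norm v *\<^sub>R c v" using False by (auto simp: c_def)
    then show ?thesis ..
  qed
  have "norm (X (c v) - X (c w)) \<le> \<bar>L\<bar> * norm (v - w)" for v w
  proof -
    have "norm (X (c v) - X (c w)) \<le> L * norm (c v - c w)" by (intro lip c_in)
    also have "\<dots> \<le> \<bar>L\<bar> * norm (v - w)" by (intro mult_mono c_lip) auto
    finally show ?thesis .
  qed
  then obtain \<gamma> where \<gamma>0: "\<gamma> 0 = q"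
    and \<gamma>: "\<And>t. (\<gamma> has_vector_derivative X (c (\<gamma> t))) (at t)"
    by (rule global_lipschitz_solution[of "\<lambda>v. X (c v)" "\<bar>L\<bar>" q]) blast
  have orth: "v \<bullet> X (c v) = 0" for v
    using c_scale[of v] tangent[OF c_in[of v]] by (metis inner_scaleR_left mult_zero_right)
  have "((\<lambda>t. \<gamma> t \<bullet> \<gamma> t) has_vector_derivative 0) (at t within UNIV)" for t
  proof -
    have "((\<lambda>t. \<gamma> t \<bullet> \<gamma> t) has_vector_derivative \<gamma> t \<bullet> X (c (\<gamma> t)) + X (c (\<gamma> t)) \<bullet> \<gamma> t) (at t)"
      by (intro bounded_bilinear.has_vector_derivative[OF bounded_bilinear_inner] \<gamma>)
    then show ?thesis using orth by (simp add: inner_commute)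
  qed
  then obtain k where k: "\<And>t. t \<in> UNIV \<Longrightarrow> \<gamma> t \<bullet> \<gamma> t = k"
    by (rule has_vector_derivative_zero_constant[OF convex_UNIV]) blast
  have "norm (\<gamma> t) = 1" for t
    using k[of t] k[of 0] \<gamma>0 q by (simp add: norm_eq_sqrt_inner)
  then have "\<gamma> t \<in> sphere 0 1" for t by simp
  moreover have "c (\<gamma> t) = \<gamma> t" for t
    using \<open>\<gamma> t \<in> sphere 0 1\<close> by (simp add: c_def closest_point_self)
  ultimately show ?thesis using that[of \<gamma>] \<gamma> \<gamma>0 by simp
qed

lemma periodic_orbitE:
  assumes "periodic_orbit X C" "q \<in> C"
  obtains \<gamma> T where "\<And>t. \<gamma> t \<in> S2" "\<And>t. (\<gamma> has_vector_derivative X (\<gamma> t)) (at t)"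
    "T > 0" "\<And>t. \<gamma> (t + T) = \<gamma> t" "\<not> \<gamma> constant_on UNIV" "C = range \<gamma>" "\<gamma> 0 = q"
proof -
  obtain \<gamma> T where \<gamma>: "\<And>t. \<gamma> t \<in> S2" "\<And>t. (\<gamma> has_vector_derivative X (\<gamma> t)) (at t)"
    "T > 0" "\<And>t. \<gamma> (t + T) = \<gamma> t" "\<not> \<gamma> constant_on UNIV" "C = range \<gamma>"
    using assms(1) by (auto simp: periodic_orbit_def)
  obtain s where s: "q = \<gamma> s" using assms(2) \<gamma>(6) by auto
  have shift: "range (\<lambda>t. \<gamma> (s + t)) = range \<gamma>"
    by (auto simp: image_iff) (metis add_diff_cancel_left' add.commute diff_add_cancel)
  show ?thesis
  proof (rule that[of "\<lambda>t. \<gamma> (s + t)" T])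
    show "((\<lambda>t. \<gamma> (s + t)) has_vector_derivative X (\<gamma> (s + t))) (at t)" for t
      using has_vector_derivative_affine_arg[of \<gamma> "X (\<gamma> (s + t))" s 1 t] \<gamma>(2) by simp
    show "\<not> (\<lambda>t. \<gamma> (s + t)) constant_on UNIV"
    proof
      assume "(\<lambda>t. \<gamma> (s + t)) constant_on UNIV"
      then obtain c where "\<And>t. \<gamma> (s + t) = c" by (auto simp: constant_on_def)
      then have "\<gamma> t = c" for t by (metis add_diff_cancel_left' add.commute diff_add_cancel)
      then show False using \<gamma>(5) by (auto simp: constant_on_def)
    qed
    show "\<gamma> (s + (t + T)) = \<gamma> (s + t)" for t using \<gamma>(4)[of "s + t"] by (simp add: add.assoc)
  qed (use \<gamma> s shift in auto)
qed

lemma periodic_range: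
  fixes \<gamma> :: "real \<Rightarrow> 'a"
  assumes "T > 0" "\<And>t. \<gamma> (t + T) = \<gamma> t"
  shows "range \<gamma> = \<gamma> ` {0..T}"
proof -
  interpret periodic_fun_simple \<gamma> T by standard (rule assms)
  have "\<gamma> t \<in> \<gamma> ` {0..T}" for t
  proof
    show "\<gamma> t = \<gamma> (t - of_int \<lfloor>t / T\<rfloor> * T)" by (simp only: minus_of_int)
    show "t - of_int \<lfloor>t / T\<rfloor> * T \<in> {0..T}"
      using floor_divide_lower[OF \<open>T > 0\<close>, of t] floor_divide_upper[OF \<open>T > 0\<close>, of t]
      by (auto simp: algebra_simps)
  qed
  then show ?thesis by auto
qed

text \<open>A zero with nonzero derivative is isolated, and a compact interval holds only finitely
  many such zeros. This bounds the crossings of an orbit with the mirror plane.\<close>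

lemma finite_simple_zeros:
  fixes h :: "real \<Rightarrow> real"
  assumes h: "\<And>t. (h has_real_derivative h' t) (at t)" and simple: "\<And>t. h t = 0 \<Longrightarrow> h' t \<noteq> 0"
  shows "finite {t\<in>{a..b}. h t = 0}"
proof -
  have "\<not> z islimpt {t. h t = 0}" for z
  proof
    assume z: "z islimpt {t. h t = 0}"
    have "closed {t. h t = 0}"
      by (intro closed_Collect_eq continuous_on_const)
        (meson h DERIV_isCont continuous_at_imp_continuous_on)
    then have "h z = 0" using z closed_limpt by blast
    have "((\<lambda>t. (h t - h z) / (t - z)) \<longlongrightarrow> h' z) (at z)"
      using h has_field_derivative_iff by blast
    then have "\<forall>\<^sub>F t in at z. (h t - h z) / (t - z) \<noteq> 0"
      using simple[OF \<open>h z = 0\<close>] by (rule tendsto_imp_eventually_ne)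
    then have "\<forall>\<^sub>F t in at z. h t \<noteq> 0"
      by eventually_elim (use \<open>h z = 0\<close> in auto)
    then show False using z by (auto simp: islimpt_iff_eventually)
  qed
  then show ?thesis
    using finite_not_islimpt_in_compact[of "{a..b}" "{t. h t = 0}"] by (simp add: Int_def)
qed

subsection \<open>Reversible fields\<close>

text \<open>
  Let \<open>R\<close> be the reflection in the plane orthogonal to \<open>k\<close>. A field with \<open>X (R v) = - R (X v)\<close> is
  reversible: an orbit meeting the plane twice closes up. The orbit \<open>C\<close> crosses the plane transversally
  after one period, so by continuous dependence all orbits starting on the plane nearby meet
  it a second time, and are periodic.
\<close>

theorem reversible_no_limit_cycle:
  fixes X :: "real^3 \<Rightarrow> real^3"
  assumes lip: "\<And>v w. v \<in> cball 0 1 \<Longrightarrow> w \<in> cball 0 1 \<Longrightarrow> norm (X v - X w) \<le> L * norm (v - w)"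
    and tangent: "\<And>v. v \<in> cball 0 1 \<Longrightarrow> v \<bullet> X v = 0"
    and k: "norm k = 1" and R: "\<And>v. R v = v - (2 * (k \<bullet> v)) *\<^sub>R k"
    and rev: "\<And>v. X (R v) = - R (X v)"
    and C: "periodic_orbit X C" and q0: "q0 \<in> C" "k \<bullet> q0 = 0"
  shows "\<not> limit_cycle X C"
proof
  assume "limit_cycle X C"
  then obtain U where U: "openin (top_of_set S2) U" "C \<subseteq> U"
    and isolated: "\<And>C'. periodic_orbit X C' \<Longrightarrow> C' \<subseteq> U \<Longrightarrow> C' = C"
    by (auto simp: limit_cycle_def)
  have lipS: "norm (X v - X w) \<le> \<bar>L\<bar> * norm (v - w)" if "v \<in> S2" "w \<in> S2" for v w
  proof -
    have "norm (X v - X w) \<le> L * norm (v - w)" using that by (intro lip) auto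
    also have "\<dots> \<le> \<bar>L\<bar> * norm (v - w)" by (intro mult_right_mono) auto
    finally show ?thesis .
  qed
  obtain \<gamma> T where \<gamma>: "\<And>t. \<gamma> t \<in> S2" "\<And>t. (\<gamma> has_vector_derivative X (\<gamma> t)) (at t)"
    and T: "T > 0" "\<And>t. \<gamma> (t + T) = \<gamma> t" and nonconst: "\<not> \<gamma> constant_on UNIV"
    and C_eq: "C = range \<gamma>" and \<gamma>0: "\<gamma> 0 = q0"
    by (rule periodic_orbitE[OF C q0(1)]) blast
  have kk: "k \<bullet> k = 1" using k by (simp add: norm_eq_1)
  have R_fix: "R v = v" if "k \<bullet> v = 0" for v using that by (simp add: R)
  have R_norm: "R v \<in> S2" if "v \<in> S2" for v
  proof -
    have "R v \<bullet> R v = v \<bullet> v"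
      by (simp add: R inner_diff_left inner_diff_right kk inner_commute[of v k])
    then show ?thesis using that by (simp add: norm_eq_1)
  qed
  \<comment> \<open>On the mirror plane \<open>R\<close> fixes \<open>v\<close>, so reversibility
    makes \<open>X v\<close> a multiple of \<open>k\<close>: every nonsingular crossing is
    transversal.\<close>
  have X_normal: "X v = (k \<bullet> X v) *\<^sub>R k" if "k \<bullet> v = 0" for v
  proof -
    have "X v = - R (X v)" using rev[of v] R_fix[OF that] by simp
    then have "X v + X v = (2 * (k \<bullet> X v)) *\<^sub>R k" by (simp add: R algebra_simps)
    then have "2 *\<^sub>R X v = 2 *\<^sub>R ((k \<bullet> X v) *\<^sub>R k)" by (simp add: scaleR_2)
    then show ?thesis by (simp only: scaleR_cancel_left) simp
  qed
  define h where "h \<beta> t = k \<bullet> \<beta> t" for \<beta> :: "real \<Rightarrow> real^3" and t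
  have h: "(h \<beta> has_real_derivative k \<bullet> X (\<beta> t)) (at t)"
    if "(\<beta> has_vector_derivative X (\<beta> t)) (at t)" for \<beta> t
    unfolding h_def[abs_def] has_real_derivative_iff_has_vector_derivative
    by (rule bounded_linear.has_vector_derivative[OF bounded_linear_inner_right that])
  have simple: "k \<bullet> X (\<gamma> t) \<noteq> 0" if "k \<bullet> \<gamma> t = 0" for t
  proof
    assume "k \<bullet> X (\<gamma> t) = 0"
    then have "X (\<gamma> t) = 0" using X_normal[OF that] by simp
    have "\<gamma> s = \<gamma> t" for s
      by (rule lipschitz_solution_unique[of S2 X "\<bar>L\<bar>" \<gamma> "\<lambda>_. \<gamma> t" t])
        (use lipS \<gamma> \<open>X (\<gamma> t) = 0\<close> in auto)
    then show False using nonconst by (auto simp: constant_on_def)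
  qed
  have "C \<inter> {q. k \<bullet> q = 0} \<subseteq> \<gamma> ` {t\<in>{0..T}. h \<gamma> t = 0}"
    unfolding C_eq periodic_range[of T \<gamma>, OF T] by (auto simp: h_def)
  moreover have "finite {t\<in>{0..T}. h \<gamma> t = 0}"
    by (rule finite_simple_zeros[OF h[OF \<gamma>(2)]]) (simp add: h_def simple)
  ultimately have finite: "finite (C \<inter> {q. k \<bullet> q = 0})"
    by (meson finite_imageI finite_subset)

  obtain O' where O': "open O'" "U = S2 \<inter> O'" using U(1) by (auto simp: openin_open)
  have "compact C"
    unfolding C_eq periodic_range[of T \<gamma>, OF T]
    by (intro compact_continuous_image compact_Icc continuous_at_imp_continuous_on ballI)
      (use \<gamma>(2) has_vector_derivative_continuous in blast)
  then obtain \<epsilon> where \<epsilon>: "\<epsilon> > 0" "(\<Union>x\<in>C. ball x \<epsilon>) \<subseteq> O'"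
    using compact_subset_open_imp_ball_epsilon_subset[of C O'] O' U(2) by blast

  have hT: "h \<gamma> T = 0" using T(2)[of 0] \<gamma>0 q0(2) by (simp add: h_def)
  \<comment> \<open>The factor \<open>s\<close> normalises the direction of the crossing at time
    \<open>T\<close>, so that \<open>s * h \<gamma>\<close> increases through 0 there.\<close>
  define s where "s = sgn (k \<bullet> X (\<gamma> T))"
  have der: "((\<lambda>t. s * h \<gamma> t) has_real_derivative \<bar>k \<bullet> X (\<gamma> T)\<bar>) (at T)"
    using DERIV_cmult[OF h[OF \<gamma>(2)], of s T] by (simp add: s_def abs_sgn mult.commute)
  have pos: "\<bar>k \<bullet> X (\<gamma> T)\<bar> > 0" using simple[of T] hT by (simp add: h_def)
  obtain d1 where d1: "d1 > 0" "\<And>e. 0 < e \<Longrightarrow> e < d1 \<Longrightarrow> s * h \<gamma> T < s * h \<gamma> (T + e)"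
    using DERIV_pos_inc_right[OF der pos] by blast
  obtain d2 where d2: "d2 > 0" "\<And>e. 0 < e \<Longrightarrow> e < d2 \<Longrightarrow> s * h \<gamma> (T - e) < s * h \<gamma> T"
    using DERIV_pos_inc_left[OF der pos] by blast
  define e where "e = Min {d1, d2, T} / 2"
  have e: "0 < e" "e < d1" "e < d2" "e < T" using d1(1) d2(1) T(1) by (auto simp: e_def min_def)
  have signs: "s * h \<gamma> (T + e) > 0" "s * h \<gamma> (T - e) < 0"
    using d1(2)[of e] d2(2)[of e] e hT by auto

  \<comment> \<open>The three bounds keep a nearby solution inside the neighbourhood
    \<open>U\<close> and preserve the signs at \<open>T + e\<close> and \<open>T - e\<close>. The
    horizon is \<open>4 * T\<close> because the period found below is \<open>2 * t1\<close>, with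
    \<open>t1 \<le> T + e < 2 * T\<close>.\<close>
  define \<delta> where "\<delta> = Min {\<epsilon>, s * h \<gamma> (T + e), - s * h \<gamma> (T - e)} / exp (\<bar>L\<bar> * (4 * T))"
  have "\<delta> > 0" using \<epsilon>(1) signs by (simp add: \<delta>_def)

  \<comment> \<open>Nearby starting points on the plane give periodic orbits inside
    \<open>U\<close>, and isolation makes each of them equal to \<open>C\<close>. The contradiction
    is that \<open>C\<close> meets the plane in finitely many points only.\<close>
  have "q \<in> C" if q: "q \<in> S2" "k \<bullet> q = 0" "norm (q - q0) < \<delta>" for q
  proof -
    obtain \<beta> where \<beta>0: "\<beta> 0 = q" and \<beta>: "\<And>t. \<beta> t \<in> S2" "\<And>t. (\<beta> has_vector_derivative X (\<beta> t)) (at t)"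
      using sphere_solution[OF lip tangent] q(1) by metis
    have close: "norm (\<beta> t - \<gamma> t) < Min {\<epsilon>, s * h \<gamma> (T + e), - s * h \<gamma> (T - e)}" if "0 \<le> t" "t \<le> 4 * T" for t
    proof -
      have "norm (\<beta> t - \<gamma> t) \<le> exp (\<bar>L\<bar> * (t - 0)) * norm (\<beta> 0 - \<gamma> 0)"
        by (rule gronwall_forward[OF lipS \<beta> \<gamma> \<open>0 \<le> t\<close>])
      also have "\<dots> \<le> exp (\<bar>L\<bar> * (4 * T)) * norm (q - q0)"
        using that by (intro mult_mono) (auto simp: \<beta>0 \<gamma>0 mult_left_mono)
      also have "\<dots> < exp (\<bar>L\<bar> * (4 * T)) * \<delta>" using q(3) by simp
      finally show ?thesis by (simp add: \<delta>_def)
    qed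
    have h_close: "\<bar>s * h \<beta> t - s * h \<gamma> t\<bar> \<le> norm (\<beta> t - \<gamma> t)" for t
    proof -
      have "\<bar>k \<bullet> (\<beta> t - \<gamma> t)\<bar> \<le> norm (\<beta> t - \<gamma> t)"
        using Cauchy_Schwarz_ineq2[of k "\<beta> t - \<gamma> t"] k by simp
      moreover have "\<bar>s\<bar> \<le> 1" by (simp add: s_def abs_sgn_eq)
      ultimately have "\<bar>s\<bar> * \<bar>k \<bullet> (\<beta> t - \<gamma> t)\<bar> \<le> 1 * norm (\<beta> t - \<gamma> t)"
        by (intro mult_mono) auto
      then show ?thesis by (simp add: h_def inner_diff_right right_diff_distrib flip: abs_mult)
    qed
    have up: "s * h \<beta> (T + e) > 0"
      using h_close[of "T + e"] close[of "T + e"] e T(1) by (simp, arith)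
    have down: "s * h \<beta> (T - e) < 0"
      using h_close[of "T - e"] close[of "T - e"] e T(1) by (simp, arith)
    have "continuous_on {T - e..T + e} (\<lambda>t. s * h \<beta> t)"
      by (intro continuous_on_mult_left DERIV_continuous_on[OF has_field_derivative_at_within[OF h[OF \<beta>(2)]]])
    then have "\<exists>t\<ge>T - e. t \<le> T + e \<and> s * h \<beta> t = 0"
      by (intro IVT') (use up down e in auto)
    then obtain t1 where t1: "T - e \<le> t1" "t1 \<le> T + e" "s * h \<beta> t1 = 0" by blast
    then have kt1: "k \<bullet> \<beta> t1 = 0" using up by (auto simp: h_def)
    have R_linear: "bounded_linear R"
      unfolding R[abs_def]
      by (intro bounded_linear_sub bounded_linear_ident bounded_linear_scaleR_left[THEN bounded_linear_compose]
          bounded_linear_const_mult bounded_linear_inner_right)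
    \<comment> \<open>Reflecting space and reversing time about \<open>a\<close> gives another
      solution, and both agree at \<open>a\<close> because \<open>\<beta> a\<close> lies on the
      mirror plane.\<close>
    have mirror: "\<beta> t = R (\<beta> (2 * a - t))" if "k \<bullet> \<beta> a = 0" for a t
    proof (rule lipschitz_solution_unique[of S2 X "\<bar>L\<bar>" \<beta> "\<lambda>t. R (\<beta> (2 * a - t))" a])
      show "((\<lambda>t. R (\<beta> (2 * a - t))) has_vector_derivative X (R (\<beta> (2 * a - t)))) (at t)" for t
        using bounded_linear.has_vector_derivative[OF R_linear
            has_vector_derivative_affine_arg[of \<beta> "X (\<beta> (2 * a - t))" "2 * a" "-1" t]] \<beta>(2)[of "2 * a - t"]
        by (simp add: rev linear_neg[OF bounded_linear.linear[OF R_linear]])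
    qed (use lipS \<beta> R_norm R_fix that in auto)
    have "k \<bullet> \<beta> 0 = 0" using q(2) \<beta>0 by simp
    have R_R: "R (R v) = v" for v
      by (simp add: R inner_diff_right kk algebra_simps)
    \<comment> \<open>The time reflections about 0 and about \<open>t1\<close> compose to the
      translation by \<open>2 * t1\<close>.\<close>
    have period: "\<beta> (t + 2 * t1) = \<beta> t" for t
    proof -
      have "\<beta> (t + 2 * t1) = R (\<beta> (- t))"
        using mirror[OF kt1, of "t + 2 * t1"] by simp
      also have "\<dots> = \<beta> t"
        using mirror[OF \<open>k \<bullet> \<beta> 0 = 0\<close>, of t] by simp
      finally show ?thesis .
    qed
    have "t1 > 0" using t1(1) e by linarith
    have "periodic_orbit X (range \<beta>)"
      unfolding periodic_orbit_def
    proof (intro exI conjI allI)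
      show "\<not> \<beta> constant_on UNIV"
      proof
        assume "\<beta> constant_on UNIV"
        then have "\<beta> (T + e) = \<beta> t1" by (auto simp: constant_on_def)
        then show False using up kt1 by (simp add: h_def)
      qed
      show "0 < 2 * t1" using \<open>t1 > 0\<close> by simp
    qed (use \<beta> period in auto)
    moreover have "range \<beta> \<subseteq> U"
    proof -
      have "\<beta> t \<in> U" if "t \<in> {0..2 * t1}" for t
      proof -
        have "norm (\<beta> t - \<gamma> t) < \<epsilon>" using close[of t] that t1(2) e by simp
        then have "\<beta> t \<in> ball (\<gamma> t) \<epsilon>" by (simp add: dist_norm norm_minus_commute)
        then have "\<beta> t \<in> O'" using \<epsilon>(2) C_eq by blast
        then show ?thesis using O'(2) \<beta>(1) by blast
      qed
      then show ?thesis
        using periodic_range[of "2 * t1" \<beta>] period \<open>t1 > 0\<close> by auto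
    qed
    ultimately show ?thesis using isolated \<beta>0 by blast
  qed
  then have "S2 \<inter> {q. k \<bullet> q = 0} \<inter> ball q0 \<delta> \<subseteq> C \<inter> {q. k \<bullet> q = 0}"
    by (auto simp: dist_norm norm_minus_commute)
  then have fin: "finite (S2 \<inter> {q. k \<bullet> q = 0} \<inter> ball q0 \<delta>)" using finite by (rule finite_subset)

  have "q0 \<in> S2" using \<gamma>(1)[of 0] \<gamma>0 by simp
  \<comment> \<open>An arc of the great circle in the mirror plane, starting at \<open>q0\<close> in
    direction \<open>m\<close>, supplies infinitely many starting points; its length stays below
    \<open>pi / 2\<close>, where the sine is injective.\<close>
  define m where "m = cross3 k q0"
  have m: "q0 \<bullet> m = 0" "k \<bullet> m = 0" by (simp_all add: m_def dot_cross_self)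
  have "norm m = 1"
    using norm_cross_dot[of k q0] q0(2) k \<open>q0 \<in> S2\<close> by (simp add: m_def power2_eq_1_iff)
  then have mm: "m \<bullet> m = 1" by (simp add: norm_eq_1)
  have q00: "q0 \<bullet> q0 = 1" using \<open>q0 \<in> S2\<close> by (simp add: norm_eq_1)
  define c where "c t = cos t *\<^sub>R q0 + sin t *\<^sub>R m" for t
  have "continuous (at 0) c" unfolding c_def by (intro continuous_intros)
  then obtain d where d: "d > 0" "\<And>t. \<bar>t\<bar> < d \<Longrightarrow> dist (c t) (c 0) < \<delta>"
    using \<open>\<delta> > 0\<close> unfolding continuous_at_eps_delta by (auto simp: dist_real_def)
  define b where "b = min d (pi / 2)"
  have "c t \<in> S2 \<inter> {q. k \<bullet> q = 0} \<inter> ball q0 \<delta>" if "t \<in> {0<..<b}" for t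
  proof -
    have "c t \<bullet> c t = (cos t)\<^sup>2 + (sin t)\<^sup>2"
      by (simp add: c_def inner_add_left inner_add_right m inner_commute[of m q0] q00 mm power2_eq_square)
    moreover have "k \<bullet> c t = 0" by (simp add: c_def inner_add_right m q0(2))
    moreover have "dist (c t) q0 < \<delta>" using d(2)[of t] that by (simp add: b_def c_def)
    ultimately show ?thesis by (simp add: norm_eq_1 dist_commute)
  qed
  then have "finite (c ` {0<..<b})" using fin by (meson finite_subset image_subsetI)
  moreover have "inj_on c {0<..<b}"
  proof (rule inj_onI)
    fix t t' assume t: "t \<in> {0<..<b}" "t' \<in> {0<..<b}" "c t = c t'"
    have mc: "m \<bullet> c r = sin r" for r by (simp add: c_def inner_add_right inner_commute[of m q0] m mm)
    have "sin t = sin t'" unfolding mc[symmetric] t(3) ..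
    then show "t = t'" by (rule sin_inj_pi[rotated -1]) (use t in \<open>simp_all add: b_def\<close>)
  qed
  ultimately have "finite {0<..<b}" using finite_imageD by blast
  moreover have "0 < b" using d(1) by (simp add: b_def)
  ultimately show False using infinite_Ioo by blast
qed

subsection \<open>Quadratic fields in orthonormal frames\<close>

unbundle cross3_syntax

text \<open>The orientation is fixed because the field is a cross product: its coordinates then
  carry definite signs and permute cyclically.\<close>

definition right_frame :: "real^3 \<Rightarrow> real^3 \<Rightarrow> real^3 \<Rightarrow> bool" where
  "right_frame u1 u2 u3 \<longleftrightarrow> u1 \<bullet> u1 = 1 \<and> u2 \<bullet> u2 = 1 \<and> u1 \<bullet> u2 = 0 \<and> u3 = u1 \<times> u2"

lemma right_frame_inner:
  assumes "right_frame u1 u2 u3"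
  shows "u1 \<bullet> u1 = 1" "u2 \<bullet> u2 = 1" "u3 \<bullet> u3 = 1"
    "u1 \<bullet> u2 = 0" "u2 \<bullet> u1 = 0" "u1 \<bullet> u3 = 0" "u3 \<bullet> u1 = 0" "u2 \<bullet> u3 = 0" "u3 \<bullet> u2 = 0"
proof -
  show "u1 \<bullet> u1 = 1" "u2 \<bullet> u2 = 1" "u1 \<bullet> u2 = 0"
    using assms by (auto simp: right_frame_def)
  moreover have "(norm (u1 \<times> u2))\<^sup>2 = 1"
    using calculation norm_cross_dot[of u1 u2] by (simp flip: norm_eq_1)
  ultimately show "u2 \<bullet> u1 = 0" "u3 \<bullet> u3 = 1"
    using assms by (auto simp: right_frame_def inner_commute power2_norm_eq_inner)
  show "u1 \<bullet> u3 = 0" "u3 \<bullet> u1 = 0" "u2 \<bullet> u3 = 0" "u3 \<bullet> u2 = 0"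
    using assms by (auto simp: right_frame_def dot_cross_self)
qed

lemma right_frame_expand:
  assumes "right_frame u1 u2 u3"
  shows "v = (u1 \<bullet> v) *\<^sub>R u1 + (u2 \<bullet> v) *\<^sub>R u2 + (u3 \<bullet> v) *\<^sub>R u3"
proof -
  note f = right_frame_inner[OF assms]
  define e :: "real^3^2" where "e = vector [u1, u2]"
  have frame: "orthonormal_frame u3 e"
    by (simp add: orthonormal_frame_def forall_2 e_def tangent_space_def f)
  have unit: "u3 \<in> S2" using f by (simp add: norm_eq_1)
  have "v - (u3 \<bullet> v) *\<^sub>R u3 \<in> tangent_space u3"
    by (simp add: tangent_space_def inner_diff_right f)
  then have "v - (u3 \<bullet> v) *\<^sub>R u3 =
      (\<Sum>i\<in>UNIV. (e $ i \<bullet> (v - (u3 \<bullet> v) *\<^sub>R u3)) *\<^sub>R e $ i)"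
    by (rule orthonormal_frame_expand[OF unit frame])
  then have "v - (u3 \<bullet> v) *\<^sub>R u3 = (u1 \<bullet> v) *\<^sub>R u1 + (u2 \<bullet> v) *\<^sub>R u2"
    by (simp add: sum_2 e_def inner_diff_right f)
  then show ?thesis by (rule diff_eq_eq[THEN iffD1])
qed

lemma right_frame_eqI:
  assumes "right_frame u1 u2 u3" "u1 \<bullet> v = u1 \<bullet> w" "u2 \<bullet> v = u2 \<bullet> w" "u3 \<bullet> v = u3 \<bullet> w"
  shows "v = w"
  using right_frame_expand[OF assms(1), of v] right_frame_expand[OF assms(1), of w] assms(2-4) by simp

lemma right_frame_inner_sum:
  assumes "right_frame u1 u2 u3"
  shows "v \<bullet> w = (u1 \<bullet> v) * (u1 \<bullet> w) + (u2 \<bullet> v) * (u2 \<bullet> w) + (u3 \<bullet> v) * (u3 \<bullet> w)"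
  by (subst right_frame_expand[OF assms, of v]) (simp add: inner_add_left)

lemma right_frame_cyclic:
  assumes "right_frame u1 u2 u3"
  shows "right_frame u2 u3 u1"
proof -
  note f = right_frame_inner[OF assms]
  have "u1 = u2 \<times> u3"
    using assms f Lagrange[of u2 u1 u2] by (simp add: right_frame_def)
  then show ?thesis using f by (simp add: right_frame_def)
qed

lemma right_frame_cross:
  assumes "right_frame u1 u2 u3"
  shows "u1 \<bullet> (v \<times> w) = (u2 \<bullet> v) * (u3 \<bullet> w) - (u3 \<bullet> v) * (u2 \<bullet> w)"
    and "u2 \<bullet> (v \<times> w) = (u3 \<bullet> v) * (u1 \<bullet> w) - (u1 \<bullet> v) * (u3 \<bullet> w)"
    and "u3 \<bullet> (v \<times> w) = (u1 \<bullet> v) * (u2 \<bullet> w) - (u2 \<bullet> v) * (u1 \<bullet> w)"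
proof -
  have u: "u3 = u1 \<times> u2" "u1 = u2 \<times> u3" "u2 = u3 \<times> u1"
    using assms right_frame_cyclic[OF assms] right_frame_cyclic[OF right_frame_cyclic[OF assms]]
    by (auto simp: right_frame_def)
  have *: "(a \<times> b) \<bullet> (v \<times> w) = (a \<bullet> v) * (b \<bullet> w) - (b \<bullet> v) * (a \<bullet> w)" for a b
    by (simp add: dot_cross inner_commute)
  show "u1 \<bullet> (v \<times> w) = (u2 \<bullet> v) * (u3 \<bullet> w) - (u3 \<bullet> v) * (u2 \<bullet> w)"
    by (subst u(2)) (rule *)
  show "u2 \<bullet> (v \<times> w) = (u3 \<bullet> v) * (u1 \<bullet> w) - (u1 \<bullet> v) * (u3 \<bullet> w)"
    by (subst u(3)) (rule *)
  show "u3 \<bullet> (v \<times> w) = (u1 \<bullet> v) * (u2 \<bullet> w) - (u2 \<bullet> v) * (u1 \<bullet> w)"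
    by (subst u(1)) (rule *)
qed

lemma right_frame_rotate:
  assumes "right_frame u1 u2 u3" "c\<^sup>2 + s\<^sup>2 = 1"
  shows "right_frame (c *\<^sub>R u1 + s *\<^sub>R u2) (c *\<^sub>R u2 - s *\<^sub>R u1) u3"
proof -
  note f = right_frame_inner[OF assms(1)]
  have "u3 = u1 \<times> u2" using assms(1) by (simp add: right_frame_def)
  have "(c *\<^sub>R u1 + s *\<^sub>R u2) \<times> (c *\<^sub>R u2 - s *\<^sub>R u1) = (c\<^sup>2 + s\<^sup>2) *\<^sub>R u3"
    by (rule right_frame_eqI[OF assms(1)])
      (simp_all add: right_frame_cross[OF assms(1)] inner_add_right inner_diff_right f power2_eq_square)
  then show ?thesis
    using assms(2) f
    by (simp add: right_frame_def inner_add_left inner_add_right inner_diff_left inner_diff_right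
        power2_eq_square)
qed

lemma right_frame_exists:
  assumes "norm k = 1"
  obtains u2 u3 where "right_frame k u2 u3"
proof -
  obtain e where "orthonormal_frame k e" using orthonormal_frame_exists[of k] assms by auto
  then have "right_frame k (e$1) (k \<times> e$1)"
    using assms by (auto simp: right_frame_def orthonormal_frame_def tangent_space_def norm_eq_1)
  then show ?thesis using that by blast
qed

section \<open>Fields of the form \<open>v \<times> M v\<close>\<close>

definition quadratic_field :: "real^3^3 \<Rightarrow> real^3 \<Rightarrow> real^3" where
  "quadratic_field M v = v \<times> (M *v v)"

lemma quadratic_field_tangent: "v \<bullet> quadratic_field M v = 0"
  by (simp add: quadratic_field_def dot_cross_self)

text \<open>
  The ten coefficients of the cubic form \<open>v \<bullet> X v\<close> vanish; the remaining eight parameters of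
  \<open>X\<close> are the entries of \<open>M\<close> modulo multiples of the identity.
\<close>

lemma quadratic_field_exists:
  assumes "homogeneous_vf_on_S2 2 X"
  obtains M where "X = quadratic_field M"
proof -
  have hom: "homogeneous_polynomial 2 (\<lambda>v. X v $ i)" for i
    using assms by (simp add: homogeneous_vf_on_S2_def)
  have scale: "X (a *\<^sub>R v) = a\<^sup>2 *\<^sub>R X v" for a v
    using homogeneous_polynomial_scale[OF hom] by (simp add: vec_eq_iff)
  have tangent: "v \<bullet> X v = 0" for v
  proof (cases "v = 0")
    case False
    then have "sgn v \<in> S2" by (simp add: norm_sgn)
    then have "sgn v \<bullet> X (sgn v) = 0" using assms by (simp add: homogeneous_vf_on_S2_def)
    then show ?thesis using False by (simp add: sgn_div_norm scale)
  qed simp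
  have "\<forall>i. \<exists>c. \<forall>v. X v $ i = (\<Sum>k\<le>2. \<Sum>j\<le>2 - k. c k j * v$1 ^ k * v$2 ^ j * v$3 ^ (2 - k - j))"
    using hom by (simp add: homogeneous_polynomial_def)
  from choice[OF this] obtain c where c: "\<And>i v. X v $ i =
      (\<Sum>k\<le>2. \<Sum>j\<le>2 - k. c i k j * v$1 ^ k * v$2 ^ j * v$3 ^ (2 - k - j))"
    by blast
  have X: "X v $ i = c i 0 0 * (v$3)\<^sup>2 + c i 0 1 * v$2 * v$3 + c i 0 2 * (v$2)\<^sup>2
      + c i 1 0 * v$1 * v$3 + c i 1 1 * v$1 * v$2 + c i 2 0 * (v$1)\<^sup>2" for i v
    by (simp add: c numeral_2_eq_2 algebra_simps)
  have T: "x * X (vector [x, y, z]) $ 1 + y * X (vector [x, y, z]) $ 2 + z * X (vector [x, y, z]) $ 3 = 0" for x y z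
    using tangent[of "vector [x, y, z]"] by (simp add: inner_vec_def sum_3)
  note T = T[unfolded X vector_3]
  \<comment> \<open>Evaluating the cubic form at axis points isolates the pure cubes; pairs such as
    \<open>(1, 1, 0)\<close> and \<open>(1, -1, 0)\<close> separate the mixed terms, and
    \<open>(1, 1, 1)\<close> yields the coefficient of \<open>x * y * z\<close>.\<close>
  have pure: "c 1 2 0 = 0" "c 2 0 2 = 0" "c 3 0 0 = 0"
    using T[where x=1 and y=0 and z=0] T[where x=0 and y=1 and z=0] T[where x=0 and y=0 and z=1] by simp_all
  have "(c 1 1 1 + c 2 2 0) + (c 1 0 2 + c 2 1 1) = 0" "(c 1 0 2 + c 2 1 1) - (c 1 1 1 + c 2 2 0) = 0"
    using T[where x=1 and y=1 and z=0] T[where x=1 and y="-1" and z=0] by (simp_all add: pure)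
  then have m1: "c 1 1 1 + c 2 2 0 = 0" "c 1 0 2 + c 2 1 1 = 0" by linarith+
  have "(c 1 1 0 + c 3 2 0) + (c 1 0 0 + c 3 1 0) = 0" "(c 1 0 0 + c 3 1 0) - (c 1 1 0 + c 3 2 0) = 0"
    using T[where x=1 and y=0 and z=1] T[where x=1 and y=0 and z="-1"] by (simp_all add: pure)
  then have m2: "c 1 1 0 + c 3 2 0 = 0" "c 1 0 0 + c 3 1 0 = 0" by linarith+
  have "(c 2 0 1 + c 3 0 2) + (c 2 0 0 + c 3 0 1) = 0" "(c 2 0 0 + c 3 0 1) - (c 2 0 1 + c 3 0 2) = 0"
    using T[where x=0 and y=1 and z=1] T[where x=0 and y=1 and z="-1"] by (simp_all add: pure)
  then have m3: "c 2 0 1 + c 3 0 2 = 0" "c 2 0 0 + c 3 0 1 = 0" by linarith+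
  have mixed: "c 2 2 0 = - c 1 1 1" "c 2 1 1 = - c 1 0 2" "c 3 2 0 = - c 1 1 0"
      "c 3 1 0 = - c 1 0 0" "c 3 0 2 = - c 2 0 1" "c 3 0 1 = - c 2 0 0"
    using m1 m2 m3 by linarith+
  have "c 3 1 1 = - c 1 0 1 - c 2 1 0"
    using T[where x=1 and y=1 and z=1] by (simp add: pure mixed del: One_nat_def)
  note rel = pure mixed this
  \<comment> \<open>The freedom to add multiples of the identity is used to make the last diagonal
    entry zero.\<close>
  define M :: "real^3^3" where "M = vector [vector [c 2 1 0, c 2 0 1, c 2 0 0],
    vector [- c 1 1 0, - c 1 0 1, - c 1 0 0], vector [c 1 1 1, c 1 0 2, 0]]"
  have "X v = quadratic_field M v" for v
    by (simp add: vec_eq_iff forall_3 X quadratic_field_def cross_components M_def matrix_vector_mult_def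
        sum_3 rel power2_eq_square algebra_simps del: One_nat_def)
  then show ?thesis using that by blast
qed

lemma quadratic_field_lipschitz:
  obtains L where "\<And>v w. v \<in> cball 0 1 \<Longrightarrow> w \<in> cball 0 1 \<Longrightarrow>
    norm (quadratic_field M v - quadratic_field M w) \<le> L * norm (v - w)"
proof -
  obtain K where K: "K > 0" "\<And>x. norm (M *v x) \<le> norm x * K"
    using bounded_linear.pos_bounded[OF matrix_vector_mul_bounded_linear[of M]] by blast
  have cross: "norm (x \<times> y) \<le> norm x * norm y" for x y
    by (rule power2_le_imp_le) (use norm_cross_dot[of x y] zero_le_power2[of "x \<bullet> y"] in linarith, simp)
  have "norm (quadratic_field M v - quadratic_field M w) \<le> (2 * K) * norm (v - w)"
    if "v \<in> cball 0 1" "w \<in> cball 0 1" for v w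
  proof -
    have "quadratic_field M v - quadratic_field M w = (v - w) \<times> (M *v v) + w \<times> (M *v (v - w))"
      by (simp add: quadratic_field_def Cross3.left_diff_distrib Cross3.right_diff_distrib
          matrix_vector_mult_diff_distrib)
    also have "norm \<dots> \<le> norm ((v - w) \<times> (M *v v)) + norm (w \<times> (M *v (v - w)))"
      by (rule norm_triangle_ineq)
    also have "norm ((v - w) \<times> (M *v v)) \<le> norm (v - w) * (1 * K)"
      by (rule order_trans[OF cross], intro mult_left_mono order_trans[OF K(2)])
        (use that K(1) in auto)
    also have "norm (w \<times> (M *v (v - w))) \<le> 1 * (norm (v - w) * K)"
      by (rule order_trans[OF cross], intro mult_mono K(2)) (use that K(1) in auto)
    finally show ?thesis by (simp add: algebra_simps)
  qed
  then show ?thesis using that by blast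
qed

lemma quadratic_field_coords:
  assumes "right_frame u1 u2 u3"
  shows "u1 \<bullet> quadratic_field M v = (u2 \<bullet> v) * (u3 \<bullet> (M *v v)) - (u3 \<bullet> v) * (u2 \<bullet> (M *v v))"
    and "u2 \<bullet> quadratic_field M v = (u3 \<bullet> v) * (u1 \<bullet> (M *v v)) - (u1 \<bullet> v) * (u3 \<bullet> (M *v v))"
    and "u3 \<bullet> quadratic_field M v = (u1 \<bullet> v) * (u2 \<bullet> (M *v v)) - (u2 \<bullet> v) * (u1 \<bullet> (M *v v))"
  by (simp_all add: quadratic_field_def right_frame_cross[OF assms])

lemma right_frame_matrix:
  assumes "right_frame u1 u2 u3"
  shows "w \<bullet> (M *v v) = (w \<bullet> (M *v u1)) * (u1 \<bullet> v) + (w \<bullet> (M *v u2)) * (u2 \<bullet> v) + (w \<bullet> (M *v u3)) * (u3 \<bullet> v)"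
  by (subst right_frame_expand[OF assms, of v])
    (simp add: matrix_vector_right_distrib matrix_vector_mult_scaleR inner_add_right mult.commute)

text \<open>By uniqueness a solution through a singular point is constant. Most contradictions below
  are reached by exhibiting a singular point on the orbit.\<close>

lemma periodic_orbit_nonsingular:
  assumes "periodic_orbit (quadratic_field M) C" "q \<in> C"
  shows "quadratic_field M q \<noteq> 0"
proof
  assume zero: "quadratic_field M q = 0"
  obtain \<gamma> T where \<gamma>: "\<And>t. \<gamma> t \<in> S2" "\<And>t. (\<gamma> has_vector_derivative quadratic_field M (\<gamma> t)) (at t)"
    and nonconst: "\<not> \<gamma> constant_on UNIV" and \<gamma>0: "\<gamma> 0 = q"
    by (rule periodic_orbitE[OF assms]) blast
  obtain L where L: "\<And>v w. v \<in> cball 0 1 \<Longrightarrow> w \<in> cball 0 1 \<Longrightarrow>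
    norm (quadratic_field M v - quadratic_field M w) \<le> L * norm (v - w)"
    by (rule quadratic_field_lipschitz[of M]) blast
  have "q \<in> S2" using \<gamma>(1)[of 0] \<gamma>0 by simp
  have "\<gamma> t = q" for t
  proof (rule lipschitz_solution_unique[of S2 "quadratic_field M" L \<gamma> "\<lambda>_. q" 0])
    show "norm (quadratic_field M v - quadratic_field M w) \<le> L * norm (v - w)"
      if "v \<in> S2" "w \<in> S2" for v w by (rule L) (use that in auto)
    show "((\<lambda>_. q) has_vector_derivative quadratic_field M q) (at t)" for t
      by (simp add: zero)
  qed (fact \<gamma> \<open>q \<in> S2\<close> \<gamma>0)+
  then show False using nonconst by (auto simp: constant_on_def)
qed

text \<open>A monotone periodic function is constant; all monotone functions along the flow are
  exploited through this fact.\<close>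

lemma periodic_deriv_nonneg:
  fixes g :: "real \<Rightarrow> real"
  assumes g: "\<And>t. (g has_real_derivative g' t) (at t)" and "T > 0" and period: "\<And>t. g (t + T) = g t"
    and nonneg: "\<And>t. g' t \<ge> 0"
  shows "g' t = 0"
proof -
  have mono: "g s \<le> g r" if "s \<le> r" for s r
    by (rule DERIV_nonneg_imp_nondecreasing[OF that]) (use g nonneg in blast)
  have prev: "g (t - T) = g t" using period[of "t - T"] by simp
  have const: "g s = g t" if "s \<in> {t - T<..<t + T}" for s
  proof (cases "s \<le> t")
    case True
    have "g (t - T) \<le> g s" by (rule mono) (use that in simp)
    with mono[OF True] prev show ?thesis by linarith
  next
    case False
    have "g s \<le> g (t + T)" "g t \<le> g s" by (rule mono, use that False in simp)+
    with period[of t] show ?thesis by linarith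
  qed
  have "((\<lambda>_. g t) has_real_derivative g' t) (at t)"
    by (rule has_field_derivative_transform_within_open[OF g[of t], of "{t - T<..<t + T}"])
      (simp, simp add: \<open>T > 0\<close>, rule const)
  then show ?thesis by (rule DERIV_unique) (rule DERIV_const)
qed

lemma periodic_deriv_nonpos:
  fixes g :: "real \<Rightarrow> real"
  assumes g: "\<And>t. (g has_real_derivative g' t) (at t)" and "T > 0" and period: "\<And>t. g (t + T) = g t"
    and "\<And>t. g' t \<le> 0"
  shows "g' t = 0"
  using periodic_deriv_nonneg[of "\<lambda>t. - g t" "\<lambda>t. - g' t" T t] assms by (simp add: DERIV_minus)

lemma continuous_nonvanishing_sign:
  fixes f :: "real \<Rightarrow> real"
  assumes "continuous_on UNIV f" "\<And>t. f t \<noteq> 0"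
  shows "(\<forall>t. f t > 0) \<or> (\<forall>t. f t < 0)"
proof -
  have conn: "connected (range f)" using assms(1) by (intro connected_continuous_image) auto
  have "0 < f t" if "0 < f s" for s t
  proof (rule ccontr)
    assume "\<not> 0 < f t"
    then have "0 \<in> range f"
      using connectedD_interval[OF conn, of "f t" "f s" 0] that by simp
    then show False using assms(2) by auto
  qed
  then have "f t < 0" if "\<not> 0 < f 0" for t
    using that assms(2)[of t] by (meson linorder_less_linear)
  then show ?thesis using \<open>\<And>t s. 0 < f s \<Longrightarrow> 0 < f t\<close> by blast
qed

text \<open>A continuous nonvanishing \<open>f\<close> has one sign, so \<open>g\<close> is monotone
  whatever the sign of \<open>a\<close>; periodicity leaves only \<open>a = 0\<close>.\<close>

lemma periodic_deriv_scaled_nonvanishing: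
  fixes g :: "real \<Rightarrow> real"
  assumes g: "\<And>t. (g has_real_derivative a * f t) (at t)" and T: "T > 0" "\<And>t. g (t + T) = g t"
    and f: "continuous_on UNIV f" "\<And>t. f t \<noteq> 0"
  shows "a = 0"
proof -
  have "(\<forall>t. a * f t \<ge> 0) \<or> (\<forall>t. a * f t \<le> 0)"
    using continuous_nonvanishing_sign[OF f] by (cases "a \<ge> 0") (auto simp: mult_le_0_iff zero_le_mult_iff less_imp_le)
  then have "a * f 0 = 0"
    using periodic_deriv_nonneg[OF g T] periodic_deriv_nonpos[OF g T] by blast
  then show ?thesis using f(2) by simp
qed

subsection \<open>Matrices with a common left and right eigenvector\<close>

lemma has_real_derivative_inner_right:
  assumes "(\<gamma> has_vector_derivative w) (at t)"
  shows "((\<lambda>t. u \<bullet> \<gamma> t) has_real_derivative u \<bullet> w) (at t)"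
  unfolding has_real_derivative_iff_has_vector_derivative
  by (rule bounded_linear.has_vector_derivative[OF bounded_linear_inner_right assms])

lemma periodic_deriv_semidefinite:
  fixes g :: "real \<Rightarrow> real"
  assumes g: "\<And>t. (g has_real_derivative g' t) (at t)" and T: "T > 0" "\<And>t. g (t + T) = g t"
    and sign: "(\<forall>t. g' t \<ge> 0) \<or> (\<forall>t. g' t \<le> 0)"
  shows "g' t = 0"
  using sign periodic_deriv_nonneg[of g g' T t, OF g T] periodic_deriv_nonpos[of g g' T t, OF g T] by blast

text \<open>The expression is the off-diagonal entry of a symmetric planar form after rotation by an
  angle with cosine \<open>c\<close> and sine \<open>s\<close>; \<open>\<delta>\<close> is the
  difference of the diagonal entries. A quarter turn changes its sign, so it vanishes in
  between.\<close>

lemma symmetric_form_diagonalizable: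
  fixes \<beta> \<delta> :: real
  obtains c s where "c\<^sup>2 + s\<^sup>2 = 1" "(c\<^sup>2 - s\<^sup>2) * \<beta> + c * s * \<delta> = 0"
proof -
  define f where "f t = ((cos t)\<^sup>2 - (sin t)\<^sup>2) * \<beta> + cos t * sin t * \<delta>" for t
  have cont: "continuous_on A f" for A unfolding f_def by (intro continuous_intros)
  have f: "f 0 = \<beta>" "f (pi / 2) = - \<beta>" by (simp_all add: f_def)
  have "\<exists>t. f t = 0"
  proof (cases "\<beta> \<ge> 0")
    case True
    then show ?thesis using IVT2'[of f "pi / 2" 0 0] f cont by auto
  next
    case False
    then show ?thesis using IVT'[of f 0 0 "pi / 2"] f cont by auto
  qed
  then obtain t where "f t = 0" ..
  then show ?thesis using that[of "cos t" "sin t"] by (simp add: f_def)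
qed

text \<open>A common left and right eigenvector \<open>k\<close> makes \<open>M\<close> commute with
  \<open>R\<close>, and a reflection, having determinant -1, satisfies
  \<open>R v \<times> R w = - R (v \<times> w)\<close>.\<close>

lemma reflection_reverses:
  assumes k: "norm k = 1" and eigen: "M *v k = \<mu> *\<^sub>R k" and left: "\<And>v. k \<bullet> (M *v v) = \<mu> * (k \<bullet> v)"
    and R: "\<And>v. R v = v - (2 * (k \<bullet> v)) *\<^sub>R k"
  shows "quadratic_field M (R v) = - R (quadratic_field M v)"
proof -
  obtain u2 u3 where frame: "right_frame k u2 u3" using right_frame_exists[OF k] by blast
  note f = right_frame_inner[OF frame]
  have MR: "M *v (R v) = M *v v - (2 * (k \<bullet> v) * \<mu>) *\<^sub>R k"
    by (simp add: R matrix_vector_mult_diff_distrib matrix_vector_mult_scaleR eigen)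
  show ?thesis
    by (intro right_frame_eqI[OF frame])
      (simp_all add: quadratic_field_coords[OF frame] MR inner_diff_right f left,
        simp_all add: R inner_diff_right f quadratic_field_coords[OF frame] left algebra_simps)
qed

lemma eigenplane_touched_no_limit_cycle:
  assumes k: "norm k = 1" and eigen: "M *v k = \<mu> *\<^sub>R k" and left: "\<And>v. k \<bullet> (M *v v) = \<mu> * (k \<bullet> v)"
    and "q \<in> C" "k \<bullet> q = 0"
  shows "\<not> limit_cycle (quadratic_field M) C"
proof
  assume lc: "limit_cycle (quadratic_field M) C"
  then have per: "periodic_orbit (quadratic_field M) C" by (simp add: limit_cycle_def)
  define R where "R v = v - (2 * (k \<bullet> v)) *\<^sub>R k" for v
  obtain L where L: "\<And>v w. v \<in> cball 0 1 \<Longrightarrow> w \<in> cball 0 1 \<Longrightarrow>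
    norm (quadratic_field M v - quadratic_field M w) \<le> L * norm (v - w)"
    by (rule quadratic_field_lipschitz[of M]) blast
  have "\<not> limit_cycle (quadratic_field M) C"
    by (rule reversible_no_limit_cycle[OF L quadratic_field_tangent k R_def
        reflection_reverses[OF k eigen left R_def] per \<open>q \<in> C\<close> \<open>k \<bullet> q = 0\<close>])
  then show False using lc by blast
qed

text \<open>The equations are of the type of Euler's rigid body equations, with three mirror planes.
  On a limit cycle no coordinate may vanish, so the derivative of each one is a difference of
  eigenvalues times a function of constant sign. Periodicity makes all eigenvalues equal, and then
  the field is zero.\<close>

lemma diagonal_no_limit_cycle:
  assumes frame: "right_frame u1 u2 u3"
    and eigen: "M *v u1 = \<mu>1 *\<^sub>R u1" "M *v u2 = \<mu>2 *\<^sub>R u2" "M *v u3 = \<mu>3 *\<^sub>R u3"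
  shows "\<not> limit_cycle (quadratic_field M) C"
proof
  assume lc: "limit_cycle (quadratic_field M) C"
  then have per: "periodic_orbit (quadratic_field M) C" by (simp add: limit_cycle_def)
  note f = right_frame_inner[OF frame]
  have left: "u1 \<bullet> (M *v v) = \<mu>1 * (u1 \<bullet> v)" "u2 \<bullet> (M *v v) = \<mu>2 * (u2 \<bullet> v)"
    "u3 \<bullet> (M *v v) = \<mu>3 * (u3 \<bullet> v)" for v
    by (simp_all add: right_frame_matrix[OF frame, of _ M v] eigen f)
  have norms: "norm u1 = 1" "norm u2 = 1" "norm u3 = 1" using f by (simp_all add: norm_eq_1)
  have nz: "u1 \<bullet> q \<noteq> 0" "u2 \<bullet> q \<noteq> 0" "u3 \<bullet> q \<noteq> 0" if "q \<in> C" for q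
    using eigenplane_touched_no_limit_cycle[OF norms(1) eigen(1) left(1) that]
      eigenplane_touched_no_limit_cycle[OF norms(2) eigen(2) left(2) that]
      eigenplane_touched_no_limit_cycle[OF norms(3) eigen(3) left(3) that] lc by blast+
  obtain q where "q \<in> C" using per by (auto simp: periodic_orbit_def)
  obtain \<gamma> T where \<gamma>: "\<And>t. (\<gamma> has_vector_derivative quadratic_field M (\<gamma> t)) (at t)"
    and T: "T > 0" "\<And>t. \<gamma> (t + T) = \<gamma> t" and C: "C = range \<gamma>"
    by (rule periodic_orbitE[OF per \<open>q \<in> C\<close>]) blast
  have coords: "u1 \<bullet> quadratic_field M v = (\<mu>3 - \<mu>2) * ((u2 \<bullet> v) * (u3 \<bullet> v))"
    "u2 \<bullet> quadratic_field M v = (\<mu>1 - \<mu>3) * ((u3 \<bullet> v) * (u1 \<bullet> v))"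
    "u3 \<bullet> quadratic_field M v = (\<mu>2 - \<mu>1) * ((u1 \<bullet> v) * (u2 \<bullet> v))" for v
    by (simp_all add: quadratic_field_coords[OF frame] left algebra_simps)
  have cont: "continuous_on UNIV (\<lambda>t. u \<bullet> \<gamma> t)" for u
    by (rule DERIV_continuous_on[OF has_field_derivative_at_within[OF has_real_derivative_inner_right[OF \<gamma>]]])
  have zero: "a = 0" if u: "\<And>v. u \<bullet> quadratic_field M v = a * ((w \<bullet> v) * (w' \<bullet> v))"
      and nz: "\<And>t. w \<bullet> \<gamma> t \<noteq> 0" "\<And>t. w' \<bullet> \<gamma> t \<noteq> 0" for a u w w'
  proof (rule periodic_deriv_scaled_nonvanishing[of "\<lambda>t. u \<bullet> \<gamma> t" a "\<lambda>t. (w \<bullet> \<gamma> t) * (w' \<bullet> \<gamma> t)" T])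
    show "((\<lambda>t. u \<bullet> \<gamma> t) has_real_derivative a * ((w \<bullet> \<gamma> t) * (w' \<bullet> \<gamma> t))) (at t)" for t
      using has_real_derivative_inner_right[OF \<gamma>, of u t] by (simp only: u)
    show "continuous_on UNIV (\<lambda>t. (w \<bullet> \<gamma> t) * (w' \<bullet> \<gamma> t))" by (intro continuous_on_mult cont)
  qed (simp_all add: T nz)
  have "\<mu>3 - \<mu>2 = 0" "\<mu>1 - \<mu>3 = 0" "\<mu>2 - \<mu>1 = 0"
    by (rule zero[OF coords(1)] zero[OF coords(2)] zero[OF coords(3)]; simp add: nz C)+
  then have "quadratic_field M q = 0"
    by (intro right_frame_eqI[OF frame]) (simp_all add: coords)
  then show False using periodic_orbit_nonsingular[OF per \<open>q \<in> C\<close>] by simp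
qed

text \<open>
  Off the invariant plane \<open>x = k \<bullet> v = 0\<close> the orthogonal coordinates \<open>w = (y, z)\<close> obey the linear
  system \<open>w' = x B w\<close>. If \<open>tr B \<noteq> 0\<close> the square of \<open>w \<times> B w\<close> is strictly monotone unless \<open>w\<close> is an
  eigenvector of \<open>B\<close>; if \<open>tr B = 0\<close> then \<open>M\<close> is symmetric.
\<close>

theorem eigenplane_no_limit_cycle:
  assumes k: "norm k = 1" and eigen: "M *v k = \<mu> *\<^sub>R k" and left: "\<And>v. k \<bullet> (M *v v) = \<mu> * (k \<bullet> v)"
  shows "\<not> limit_cycle (quadratic_field M) C"
proof
  assume lc: "limit_cycle (quadratic_field M) C"
  then have per: "periodic_orbit (quadratic_field M) C" by (simp add: limit_cycle_def)
  obtain u2 u3 where frame: "right_frame k u2 u3" using right_frame_exists[OF k] by blast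
  note f = right_frame_inner[OF frame]
  define \<alpha> where "\<alpha> = u2 \<bullet> (M *v u2) - \<mu>"
  define \<beta> where "\<beta> = u2 \<bullet> (M *v u3)"
  define \<eta> where "\<eta> = u3 \<bullet> (M *v u2)"
  define \<delta> where "\<delta> = u3 \<bullet> (M *v u3) - \<mu>"
  show False
  proof (cases "\<beta> = \<eta>")
    case True
    obtain c s where cs: "c\<^sup>2 + s\<^sup>2 = 1" "(c\<^sup>2 - s\<^sup>2) * \<beta> + c * s * (\<delta> - \<alpha>) = 0"
      by (rule symmetric_form_diagonalizable) blast
    define w2 where "w2 = c *\<^sub>R u2 + s *\<^sub>R u3"
    define w3 where "w3 = c *\<^sub>R u3 - s *\<^sub>R u2"
    have frame': "right_frame w2 w3 k"
      unfolding w2_def w3_def by (rule right_frame_rotate[OF right_frame_cyclic[OF frame] cs(1)])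
    note f' = right_frame_inner[OF frame']
    have "w3 \<bullet> (M *v w2) = (c\<^sup>2 - s\<^sup>2) * \<beta> + c * s * (\<delta> - \<alpha>)"
      "w2 \<bullet> (M *v w3) = (c\<^sup>2 - s\<^sup>2) * \<beta> + c * s * (\<delta> - \<alpha>)"
      using True
      by (simp_all add: w2_def w3_def matrix_vector_right_distrib matrix_vector_mult_diff_distrib
          matrix_vector_mult_scaleR inner_add_left inner_add_right inner_diff_left inner_diff_right
          \<alpha>_def \<beta>_def \<eta>_def \<delta>_def power2_eq_square algebra_simps)
    then have off: "w3 \<bullet> (M *v w2) = 0" "w2 \<bullet> (M *v w3) = 0" using cs(2) by simp_all
    have "M *v w2 = (w2 \<bullet> (M *v w2)) *\<^sub>R w2" "M *v w3 = (w3 \<bullet> (M *v w3)) *\<^sub>R w3"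
      by (rule right_frame_eqI[OF frame']; simp add: f' off left)+
    then show False
      using diagonal_no_limit_cycle[OF frame' _ _ eigen] lc by blast
  next
    case False
    obtain q where "q \<in> C" using per by (auto simp: periodic_orbit_def)
    obtain \<gamma> T where \<gamma>: "\<And>t. (\<gamma> has_vector_derivative quadratic_field M (\<gamma> t)) (at t)"
      and T: "T > 0" "\<And>t. \<gamma> (t + T) = \<gamma> t" and C: "C = range \<gamma>"
      by (rule periodic_orbitE[OF per \<open>q \<in> C\<close>]) blast
    define x where "x t = k \<bullet> \<gamma> t" for t
    define y where "y t = u2 \<bullet> \<gamma> t" for t
    define z where "z t = u3 \<bullet> \<gamma> t" for t
    \<comment> \<open>With \<open>w = (y, z)\<close> one has \<open>B w = (- P, Q)\<close>. Below,
      \<open>V\<close> is \<open>w \<times> B w\<close>, \<open>S\<close> is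
      \<open>w \<bullet> B w\<close> and \<open>N\<close> is \<open>w \<bullet> w\<close>;
      \<open>\<beta> - \<eta>\<close> is the trace of \<open>B\<close>.\<close>
    define P where "P t = \<eta> * y t + \<delta> * z t" for t
    define Q where "Q t = \<alpha> * y t + \<beta> * z t" for t
    have M2: "u2 \<bullet> (M *v \<gamma> t) = Q t + \<mu> * y t" and M3: "u3 \<bullet> (M *v \<gamma> t) = P t + \<mu> * z t" for t
      by (simp_all add: right_frame_matrix[OF frame, of _ M "\<gamma> t"] eigen f P_def Q_def x_def y_def z_def
          \<alpha>_def \<beta>_def \<eta>_def \<delta>_def algebra_simps)
    have X: "k \<bullet> quadratic_field M (\<gamma> t) = y t * P t - z t * Q t"
      "u2 \<bullet> quadratic_field M (\<gamma> t) = - (x t * P t)" "u3 \<bullet> quadratic_field M (\<gamma> t) = x t * Q t" for t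
      by (simp_all add: quadratic_field_coords[OF frame] M2 M3 left algebra_simps flip: x_def y_def z_def)
    have regular: "\<not> (P t = 0 \<and> Q t = 0)" for t
    proof
      assume "P t = 0 \<and> Q t = 0"
      then have "quadratic_field M (\<gamma> t) = 0"
        by (intro right_frame_eqI[OF frame]) (simp_all add: X)
      then show False using periodic_orbit_nonsingular[OF per, of "\<gamma> t"] C by auto
    qed
    have y: "(y has_real_derivative - (x t * P t)) (at t)" for t
      using has_real_derivative_inner_right[OF \<gamma>, of u2 t] by (simp add: X y_def[abs_def])
    have z: "(z has_real_derivative x t * Q t) (at t)" for t
      using has_real_derivative_inner_right[OF \<gamma>, of u3 t] by (simp add: X z_def[abs_def])
    have period: "y (t + T) = y t" "z (t + T) = z t" for t by (simp_all add: y_def z_def T)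
    have "x t \<noteq> 0" for t
      using eigenplane_touched_no_limit_cycle[OF k eigen left, of "\<gamma> t" C] lc C by (auto simp: x_def)
    moreover have "continuous_on UNIV x"
      unfolding x_def[abs_def]
      by (rule DERIV_continuous_on[OF has_field_derivative_at_within[OF has_real_derivative_inner_right[OF \<gamma>]]])
    ultimately have x_sign: "(\<forall>t. x t > 0) \<or> (\<forall>t. x t < 0)"
      by (intro continuous_nonvanishing_sign)
    have scaled_sign: "(\<forall>t. a * x t * r t \<ge> 0) \<or> (\<forall>t. a * x t * r t \<le> 0)"
      if "\<And>t. r t \<ge> 0" for a :: real and r :: "real \<Rightarrow> real"
      using x_sign that by (cases "a \<ge> 0") (auto simp: mult_le_0_iff zero_le_mult_iff less_imp_le)

    define V where "V t = y t * Q t + z t * P t" for t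
    \<comment> \<open>By Cayley-Hamilton
      \<open>w \<times> B (B w) = tr B * (w \<times> B w)\<close>, so
      \<open>V' = (\<beta> - \<eta>) * x * V\<close>. Squaring \<open>V\<close> gives a derivative
      of constant sign.\<close>
    have "((\<lambda>t. (V t)\<^sup>2) has_real_derivative (2 * (\<beta> - \<eta>)) * x t * (V t)\<^sup>2) (at t)" for t
      unfolding V_def P_def Q_def
      by (rule derivative_eq_intros y z refl)+
        (simp add: P_def Q_def power2_eq_square algebra_simps)
    then have "(2 * (\<beta> - \<eta>)) * x t * (V t)\<^sup>2 = 0" for t
      by (rule periodic_deriv_semidefinite[OF _ T(1)])
        (simp_all only: scaled_sign zero_le_power2 V_def P_def Q_def period)
    then have V0: "V t = 0" for t using False x_sign by (metis less_irrefl mult_eq_0_iff power_eq_0_iff right_minus_eq zero_neq_numeral)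

    define S where "S t = z t * Q t - y t * P t" for t
    define N where "N t = (y t)\<^sup>2 + (z t)\<^sup>2" for t
    have N_pos: "N t > 0" for t
      using regular[of t] by (auto simp: N_def P_def Q_def sum_power2_gt_zero_iff)
    have N: "(N has_real_derivative 2 * x t * S t) (at t)" for t
      unfolding N_def[abs_def] S_def
      by (rule derivative_eq_intros y z refl)+ (simp add: algebra_simps)
    define S' where "S' t = x t * ((P t)\<^sup>2 + (Q t)\<^sup>2 + z t * (\<beta> * Q t - \<alpha> * P t) - y t * (\<delta> * Q t - \<eta> * P t))" for t
    have S: "(S has_real_derivative S' t) (at t)" for t
      unfolding S_def[abs_def] S'_def P_def[abs_def] Q_def[abs_def]
      by (rule derivative_eq_intros y z refl)+
        (simp add: P_def Q_def power2_eq_square algebra_simps)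
    \<comment> \<open>\<open>S / N\<close> is the Rayleigh quotient of \<open>w\<close>. The
      numerator of its derivative is divisible by \<open>V\<close>, so the quotient is a constant
      \<open>r\<close>, the eigenvalue of \<open>B\<close> along the orbit.\<close>
    have "S' t * N t - S t * (2 * x t * S t)
        = x t * V t * (V t + \<eta> * y t * z t - \<delta> * (y t)\<^sup>2 + \<beta> * y t * z t - \<alpha> * (z t)\<^sup>2)" for t
      by (simp add: S'_def S_def N_def V_def P_def Q_def power2_eq_square algebra_simps)
    then have "((\<lambda>t. S t / N t) has_real_derivative 0) (at t)" for t
      using DERIV_divide[OF S N, of t] N_pos[of t] V0 by simp
    then obtain r where r: "\<And>t. S t / N t = r" by (meson DERIV_isconst_all)
    then have SN: "S t = r * N t" for t using N_pos[of t] by (metis less_irrefl nonzero_eq_divide_eq)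
    have "(N has_real_derivative (2 * r) * x t * N t) (at t)" for t
      using N[of t] by (simp add: SN algebra_simps)
    moreover have "N (t + T) = N t" for t by (simp add: N_def period)
    moreover have "(\<forall>t. (2 * r) * x t * N t \<ge> 0) \<or> (\<forall>t. (2 * r) * x t * N t \<le> 0)"
      by (rule scaled_sign) (simp add: N_pos less_imp_le)
    ultimately have "(2 * r) * x t * N t = 0" for t
      by (rule periodic_deriv_semidefinite[OF _ T(1)])
    then have "S 0 = 0" using x_sign N_pos[of 0] SN[of 0] by (metis less_irrefl mult_eq_0_iff zero_neq_numeral)
    \<comment> \<open>This resolves \<open>B w\<close> along \<open>w\<close> and its quarter turn.
      Both components vanish, so the orbit would contain a singular point.\<close>
    have "N 0 * P 0 = z 0 * V 0 - y 0 * S 0" "N 0 * Q 0 = y 0 * V 0 + z 0 * S 0"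
      by (simp_all add: N_def V_def S_def power2_eq_square algebra_simps)
    then show False using V0 \<open>S 0 = 0\<close> N_pos[of 0] regular[of 0] by simp
  qed
qed

subsection \<open>Degenerate singularities\<close>

text \<open>Three dimensions leave room for a unit vector orthogonal to both \<open>n\<close> and
  \<open>m\<close>; it is a right and a left eigenvector for \<open>\<kappa>\<close>.\<close>

lemma rank_one_no_limit_cycle:
  assumes M: "\<And>v. M *v v = \<kappa> *\<^sub>R v + (n \<bullet> v) *\<^sub>R m"
  shows "\<not> limit_cycle (quadratic_field M) C"
proof -
  have "dim {n, m} \<le> card {n, m}" by (rule dim_le_card') simp
  also have "\<dots> \<le> 2" by (simp add: card_insert_if)
  finally have "dim {n, m} < DIM(real^3)" by simp
  then obtain k where k: "k \<noteq> 0" "\<And>y. y \<in> span {n, m} \<Longrightarrow> orthogonal k y"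
    by (rule orthogonal_to_subspace_exists) blast
  have "k \<bullet> n = 0" "k \<bullet> m = 0"
    using k(2)[OF span_base[of n]] k(2)[OF span_base[of m]] by (simp_all add: orthogonal_def)
  then have "sgn k \<bullet> m = 0" "n \<bullet> sgn k = 0" by (simp_all add: sgn_div_norm inner_commute)
  then show ?thesis
    by (intro eigenplane_no_limit_cycle[of "sgn k" M \<kappa>]) (simp_all add: norm_sgn k(1) M inner_add_right)
qed

text \<open>
  With \<open>(x, y, z)\<close> the coordinates of \<open>v\<close>, \<open>M v - \<kappa> v = (b y, d y, e x + g y)\<close>. For \<open>d, e \<noteq> 0\<close> the monotone
  function is the inner product with \<open>d\<close> times the eigenvector of \<open>M\<close> for the third eigenvalue \<open>\<kappa> + d\<close>.
\<close>

theorem degenerate_singularity_no_limit_cycle: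
  assumes frame: "right_frame u1 u2 u3" and eigen: "M *v u3 = \<kappa> *\<^sub>R u3"
    and deg: "u1 \<bullet> (M *v u1) = \<kappa>" "u2 \<bullet> (M *v u1) = 0"
  shows "\<not> limit_cycle (quadratic_field M) C"
proof
  assume lc: "limit_cycle (quadratic_field M) C"
  then have per: "periodic_orbit (quadratic_field M) C" by (simp add: limit_cycle_def)
  note f = right_frame_inner[OF frame]
  define b where "b = u1 \<bullet> (M *v u2)"
  define d where "d = u2 \<bullet> (M *v u2) - \<kappa>"
  define e where "e = u3 \<bullet> (M *v u1)"
  define g where "g = u3 \<bullet> (M *v u2)"
  have M: "u1 \<bullet> (M *v v) = \<kappa> * (u1 \<bullet> v) + b * (u2 \<bullet> v)"
    "u2 \<bullet> (M *v v) = \<kappa> * (u2 \<bullet> v) + d * (u2 \<bullet> v)"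
    "u3 \<bullet> (M *v v) = \<kappa> * (u3 \<bullet> v) + e * (u1 \<bullet> v) + g * (u2 \<bullet> v)" for v
    by (simp_all add: right_frame_matrix[OF frame, of _ M v] eigen f deg b_def d_def e_def g_def algebra_simps)
  obtain q where "q \<in> C" using per by (auto simp: periodic_orbit_def)
  obtain \<gamma> T where \<gamma>: "\<And>t. (\<gamma> has_vector_derivative quadratic_field M (\<gamma> t)) (at t)"
    and T: "T > 0" "\<And>t. \<gamma> (t + T) = \<gamma> t" and C: "C = range \<gamma>"
    by (rule periodic_orbitE[OF per \<open>q \<in> C\<close>]) blast
  have nonsingular: "quadratic_field M (\<gamma> t) \<noteq> 0" for t
    using periodic_orbit_nonsingular[OF per, of "\<gamma> t"] C by auto
  have lyapunov: "w \<bullet> quadratic_field M (\<gamma> t) = 0"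
    if "(\<forall>v. w \<bullet> quadratic_field M v \<ge> 0) \<or> (\<forall>v. w \<bullet> quadratic_field M v \<le> 0)" for w t
    by (rule periodic_deriv_semidefinite[OF has_real_derivative_inner_right[OF \<gamma>] T(1)])
      (use that in \<open>auto simp: T\<close>)
  have X: "u1 \<bullet> quadratic_field M v = (u2 \<bullet> v) * (e * (u1 \<bullet> v) + g * (u2 \<bullet> v) - d * (u3 \<bullet> v))"
    "u2 \<bullet> quadratic_field M v = b * (u2 \<bullet> v) * (u3 \<bullet> v) - (u1 \<bullet> v) * (e * (u1 \<bullet> v) + g * (u2 \<bullet> v))"
    "u3 \<bullet> quadratic_field M v = (u2 \<bullet> v) * (d * (u1 \<bullet> v) - b * (u2 \<bullet> v))" for v
    by (simp_all add: quadratic_field_coords[OF frame] M algebra_simps)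
  have deriv0: "w \<bullet> quadratic_field M (\<gamma> t) = 0" if "\<And>t. w \<bullet> \<gamma> t = 0" for w t
  proof (rule DERIV_unique)
    show "((\<lambda>_. 0) has_real_derivative w \<bullet> quadratic_field M (\<gamma> t)) (at t)"
      using has_real_derivative_inner_right[OF \<gamma>, of w t] by (simp add: that)
  qed (rule DERIV_const)
  \<comment> \<open>The last two cases are those in which \<open>M - \<kappa>\<close> has rank at
    most one: it depends on \<open>y\<close> alone, or takes values in the line of
    \<open>u3\<close>.\<close>
  consider "e \<noteq> 0" "d \<noteq> 0" | "e \<noteq> 0" "d = 0" "b \<noteq> 0" | "e = 0" | "d = 0" "b = 0" by blast
  then show False
  proof cases
    case 1
    define w where "w = (b * d) *\<^sub>R u1 + d\<^sup>2 *\<^sub>R u2 + (g * d + e * b) *\<^sub>R u3"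
    have w: "w \<bullet> quadratic_field M v = - e * (d * (u1 \<bullet> v) - b * (u2 \<bullet> v))\<^sup>2" for v
      by (simp add: w_def inner_add_left X power2_eq_square algebra_simps)
    have sign: "(\<forall>v. w \<bullet> quadratic_field M v \<ge> 0) \<or> (\<forall>v. w \<bullet> quadratic_field M v \<le> 0)"
      unfolding w by (cases "e \<ge> 0") (auto simp: mult_le_0_iff zero_le_mult_iff)
    have line: "d * (u1 \<bullet> \<gamma> t) = b * (u2 \<bullet> \<gamma> t)" for t
      using lyapunov[OF sign, of t] 1 unfolding w by simp
    \<comment> \<open>On the plane \<open>d * x = b * y\<close> the position and the velocity both
      have horizontal parts proportional to \<open>(b, d)\<close>, and the velocity has no
      \<open>u3\<close> component. Tangency to the sphere makes the product of the two
      proportionality factors zero.\<close>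
    define x' where "x' = u1 \<bullet> quadratic_field M (\<gamma> 0)"
    define y' where "y' = u2 \<bullet> quadratic_field M (\<gamma> 0)"
    have z': "u3 \<bullet> quadratic_field M (\<gamma> 0) = 0" by (simp add: X line)
    have xy': "d * x' = b * y'"
      using deriv0[of "d *\<^sub>R u1 - b *\<^sub>R u2" 0] line by (simp add: inner_diff_left x'_def y'_def)
    have "(u1 \<bullet> \<gamma> 0) * x' + (u2 \<bullet> \<gamma> 0) * y' = 0"
      using quadratic_field_tangent[of "\<gamma> 0" M]
      unfolding right_frame_inner_sum[OF frame, of "\<gamma> 0"] by (simp add: z' x'_def y'_def)
    then have "(d * (u1 \<bullet> \<gamma> 0)) * (d * x') + d\<^sup>2 * (u2 \<bullet> \<gamma> 0) * y' = 0"
      unfolding power2_eq_square by algebra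
    then have "(b\<^sup>2 + d\<^sup>2) * ((u2 \<bullet> \<gamma> 0) * y') = 0"
      unfolding xy' line by (simp add: power2_eq_square algebra_simps)
    then consider "u2 \<bullet> \<gamma> 0 = 0" | "y' = 0" using 1 by (auto simp: sum_power2_eq_zero_iff)
    then have "x' = 0 \<and> y' = 0"
    proof cases
      case 1
      then have "u1 \<bullet> \<gamma> 0 = 0" using line[of 0] \<open>d \<noteq> 0\<close> by simp
      then show ?thesis using 1 by (simp add: x'_def y'_def X)
    next
      case 2
      then show ?thesis using xy' \<open>d \<noteq> 0\<close> by simp
    qed
    then have "quadratic_field M (\<gamma> 0) = 0"
      by (intro right_frame_eqI[OF frame]) (simp_all add: z' flip: x'_def y'_def)
    then show False using nonsingular by blast
  next
    case 2
    \<comment> \<open>Monotonicity of the \<open>u3\<close> coordinate forces \<open>y = 0\<close>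
      along the orbit; then \<open>y' = - e * x\<^sup>2\<close> must vanish too, leaving only
      poles.\<close>
    have "u3 \<bullet> quadratic_field M v = - b * (u2 \<bullet> v)\<^sup>2" for v
      using 2 by (simp add: X power2_eq_square)
    then have sign: "(\<forall>v. u3 \<bullet> quadratic_field M v \<ge> 0) \<or> (\<forall>v. u3 \<bullet> quadratic_field M v \<le> 0)"
      by (cases "b \<ge> 0") (auto simp: mult_le_0_iff zero_le_mult_iff)
    have y0: "u2 \<bullet> \<gamma> t = 0" for t
      using lyapunov[OF sign, of t] 2 by (simp add: X)
    then have x0: "u1 \<bullet> \<gamma> t = 0" for t
      using deriv0[OF y0, of t] 2 by (simp add: X)
    have "quadratic_field M (\<gamma> 0) = 0"
      by (intro right_frame_eqI[OF frame]) (simp_all add: X x0 y0)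
    then show False using nonsingular by blast
  next
    case 3
    have "M *v v = \<kappa> *\<^sub>R v + (u2 \<bullet> v) *\<^sub>R (b *\<^sub>R u1 + d *\<^sub>R u2 + g *\<^sub>R u3)" for v
      by (rule right_frame_eqI[OF frame]) (simp_all add: M inner_add_right f 3)
    then show False using rank_one_no_limit_cycle lc by blast
  next
    case 4
    have "M *v v = \<kappa> *\<^sub>R v + ((e *\<^sub>R u1 + g *\<^sub>R u2) \<bullet> v) *\<^sub>R u3" for v
      by (rule right_frame_eqI[OF frame]) (simp_all add: M inner_add_right inner_add_left f 4)
    then show False using rank_one_no_limit_cycle lc by blast
  qed
qed

subsection \<open>A necessary condition for centers\<close>

text \<open>An orbit starting close to \<open>p\<close> is trapped within distance
  \<open>\<rho>\<close>, where \<open>V\<close> strictly decreases along it, contrary to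
  periodicity. Trapping is needed because the neighbourhood in the definition of a center may be
  large. For \<open>\<tau> = - 1\<close> time runs backwards, which covers repelling
  singularities.\<close>

lemma strict_lyapunov_not_center:
  fixes V V' :: "real^3 \<Rightarrow> real"
  assumes "\<rho> > 0" and cont: "continuous_on UNIV V" and "V p = 0"
    and pos: "\<And>v. v \<in> S2 \<Longrightarrow> v \<noteq> p \<Longrightarrow> dist v p \<le> \<rho> \<Longrightarrow> V v > 0"
    and deriv: "\<And>\<gamma> t. \<gamma> t \<in> S2 \<Longrightarrow> (\<gamma> has_vector_derivative X (\<gamma> t)) (at t) \<Longrightarrow>
      ((\<lambda>t. V (\<gamma> t)) has_real_derivative V' (\<gamma> t)) (at t)"
    and \<tau>: "\<tau> = 1 \<or> \<tau> = - 1"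
    and neg: "\<And>v. v \<in> S2 \<Longrightarrow> v \<noteq> p \<Longrightarrow> dist v p \<le> \<rho> \<Longrightarrow> \<tau> * V' v < 0"
  shows "\<not> center X p"
proof
  assume "center X p"
  then obtain U where p: "p \<in> S2" and U: "openin (top_of_set S2) U" "p \<in> U"
    and orbit: "\<And>q. q \<in> U - {p} \<Longrightarrow> \<exists>C. periodic_orbit X C \<and> q \<in> C \<and> C \<subseteq> U - {p}"
    by (auto simp: center_def singularity_def)
  obtain m where m: "m > 0" "\<And>v. v \<in> S2 \<Longrightarrow> dist v p = \<rho> \<Longrightarrow> m \<le> V v"
  proof (cases "S2 \<inter> sphere p \<rho> = {}")
    case True
    then have "dist v p \<noteq> \<rho>" if "v \<in> S2" for v using that by (auto simp: dist_commute)
    then show ?thesis using that[of 1] by auto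
  next
    case False
    have "compact (S2 \<inter> sphere p \<rho>)" by (intro compact_Int_closed) auto
    then obtain v0 where v0: "v0 \<in> S2 \<inter> sphere p \<rho>" "\<And>v. v \<in> S2 \<inter> sphere p \<rho> \<Longrightarrow> V v0 \<le> V v"
      using continuous_attains_inf[OF _ False continuous_on_subset[OF cont]] by blast
    moreover have "V v0 > 0"
      by (rule pos) (use v0 \<open>\<rho> > 0\<close> in \<open>auto simp: dist_commute\<close>)
    ultimately show ?thesis using that[of "V v0"] by (auto simp: dist_commute)
  qed
  obtain O' where O': "open O'" "U = S2 \<inter> O'" using U(1) by (auto simp: openin_open)
  define W where "W = O' \<inter> ball p \<rho> \<inter> {v. V v < m}"
  have "open {v. V v < m}" by (intro open_Collect_less cont continuous_on_const)
  then have "open W" unfolding W_def using O'(1) by (intro open_Int open_ball)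
  moreover have "p \<in> W" using U(2) O'(2) \<open>\<rho> > 0\<close> \<open>V p = 0\<close> m(1) by (auto simp: W_def)
  moreover have "p islimpt S2"
  proof (rule connected_imp_perfect[OF _ p])
    show "connected (S2 :: (real^3) set)" by (rule connected_sphere) simp
    have "p \<bullet> p = 1" using p by (simp add: norm_eq_1)
    have "- p \<noteq> p"
    proof
      assume "- p = p"
      then have "(- p) \<bullet> p = p \<bullet> p" by (rule arg_cong)
      then show False using \<open>p \<bullet> p = 1\<close> unfolding inner_minus_left by simp
    qed
    moreover have "- p \<in> S2" using p by simp
    ultimately show "S2 \<noteq> {x}" for x using p by (metis singletonD)
  qed
  ultimately obtain q where q: "q \<in> S2" "q \<in> W" "q \<noteq> p" by (auto simp: islimpt_def)
  then have "q \<in> U - {p}" using O'(2) by (auto simp: W_def)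
  then obtain C where C: "periodic_orbit X C" "q \<in> C" "C \<subseteq> U - {p}" using orbit by blast
  obtain \<gamma> T where \<gamma>: "\<And>t. \<gamma> t \<in> S2" "\<And>t. (\<gamma> has_vector_derivative X (\<gamma> t)) (at t)"
    and T: "T > 0" "\<And>t. \<gamma> (t + T) = \<gamma> t" and Ceq: "C = range \<gamma>" and \<gamma>0: "\<gamma> 0 = q"
    by (rule periodic_orbitE[OF C(1,2)]) blast
  have ne: "\<gamma> t \<noteq> p" for t using C(3) Ceq by blast
  define \<phi> where "\<phi> t = V (\<gamma> (\<tau> * t))" for t
  define D where "D t = dist (\<gamma> (\<tau> * t)) p" for t
  have \<phi>: "(\<phi> has_real_derivative \<tau> * V' (\<gamma> (\<tau> * t))) (at t)" for t
  proof -
    have "((\<lambda>t. V (\<gamma> t)) has_real_derivative V' (\<gamma> (\<tau> * t))) (at (\<tau> * t))"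
      by (rule deriv[OF \<gamma>])
    moreover have "((*) \<tau> has_real_derivative \<tau>) (at t)"
      by (auto intro!: derivative_eq_intros)
    ultimately show ?thesis
      unfolding \<phi>_def[abs_def] by (rule DERIV_chain2[THEN DERIV_cong]) simp
  qed
  have "continuous_on UNIV \<gamma>"
    by (intro continuous_at_imp_continuous_on ballI has_vector_derivative_continuous[OF \<gamma>(2)])
  then have "continuous_on A (\<lambda>t. \<gamma> (\<tau> * t))" for A
    by (rule continuous_on_compose2) (intro continuous_intros, simp)
  then have D_cont: "continuous_on A D" for A
    unfolding D_def by (intro continuous_on_dist continuous_on_const)
  have q_in: "D 0 < \<rho>" "\<phi> 0 < m"
    using q(2) \<gamma>0 by (auto simp: D_def \<phi>_def W_def dist_commute)
  \<comment> \<open>At the earliest time \<open>s\<close> of reaching distance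
    \<open>\<rho>\<close>, the value of \<open>V\<close> is at least \<open>m\<close>; but it
    started below \<open>m\<close> and has not increased up to \<open>s\<close>.\<close>
  have trapped: "D t < \<rho>" if "t \<ge> 0" for t
  proof (rule ccontr)
    assume "\<not> D t < \<rho>"
    define A where "A = {0..t} \<inter> {s. \<rho> \<le> D s}"
    have "compact A"
      unfolding A_def by (intro compact_Int_closed compact_Icc closed_Collect_le D_cont continuous_on_const)
    moreover have "t \<in> A" using \<open>\<not> D t < \<rho>\<close> \<open>t \<ge> 0\<close> by (auto simp: A_def)
    ultimately obtain s where s: "s \<in> A" "\<And>r. r \<in> A \<Longrightarrow> s \<le> r"
      using compact_attains_inf[of A] by auto
    have "s \<ge> 0" using s(1) by (simp add: A_def)
    obtain r where r: "0 \<le> r" "r \<le> s" "D r = \<rho>"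
      using IVT'[of D 0 \<rho> s] q_in(1) s(1) D_cont by (auto simp: A_def)
    then have "r \<in> A" using s(1) by (auto simp: A_def)
    with s(2) r have "r = s" by force
    have "\<phi> s \<le> \<phi> 0"
    proof (rule DERIV_nonpos_imp_nonincreasing[OF \<open>s \<ge> 0\<close>])
      fix y assume y: "0 \<le> y" "y \<le> s"
      have "D y \<le> \<rho>"
      proof (rule ccontr)
        assume "\<not> D y \<le> \<rho>"
        then have "y \<in> A" using y s(1) by (auto simp: A_def)
        then have "y = s" using s(2) y by force
        then show False using \<open>\<not> D y \<le> \<rho>\<close> r \<open>r = s\<close> by simp
      qed
      then have "\<tau> * V' (\<gamma> (\<tau> * y)) < 0" by (intro neg \<gamma> ne) (simp add: D_def)
      then show "\<exists>z. (\<phi> has_real_derivative z) (at y) \<and> z \<le> 0" using \<phi> less_imp_le by blast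
    qed
    moreover have "m \<le> \<phi> s"
      unfolding \<phi>_def by (intro m \<gamma>) (use r \<open>r = s\<close> in \<open>simp add: D_def\<close>)
    ultimately show False using q_in by simp
  qed
  have "\<phi> T < \<phi> 0"
  proof (rule DERIV_neg_imp_decreasing[OF T(1)])
    fix y assume y: "0 \<le> y" "y \<le> T"
    have "\<tau> * V' (\<gamma> (\<tau> * y)) < 0"
      by (intro neg \<gamma> ne) (use trapped[OF y(1)] in \<open>simp add: D_def\<close>)
    then show "\<exists>z. (\<phi> has_real_derivative z) (at y) \<and> z < 0" using \<phi> by blast
  qed
  moreover have "\<phi> T = \<phi> 0" using \<tau> T(2)[of 0] T(2)[of "- T"] by (auto simp: \<phi>_def)
  ultimately show False by simp
qed

lemma quartic_form_bound:
  fixes x y r :: real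
  assumes "\<bar>x\<bar> \<le> r" "\<bar>y\<bar> \<le> r"
  shows "\<bar>c0 * x^4 + c1 * (x^3 * y) + c2 * (x\<^sup>2 * y\<^sup>2) + c3 * (x * y^3) + c4 * y^4\<bar>
    \<le> (\<bar>c0\<bar> + \<bar>c1\<bar> + \<bar>c2\<bar> + \<bar>c3\<bar> + \<bar>c4\<bar>) * r^4"
proof -
  have "r \<ge> 0" using assms by linarith
  have mono: "\<bar>x^i * y^j\<bar> \<le> r^(i + j)" for i j
    unfolding abs_mult power_abs power_add
    by (intro mult_mono power_mono assms) (use \<open>r \<ge> 0\<close> in auto)
  have m: "\<bar>x^4\<bar> \<le> r^4" "\<bar>x^3 * y\<bar> \<le> r^4" "\<bar>x\<^sup>2 * y\<^sup>2\<bar> \<le> r^4" "\<bar>x * y^3\<bar> \<le> r^4" "\<bar>y^4\<bar> \<le> r^4"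
    using mono[of 4 0] mono[of 3 1] mono[of 2 2] mono[of 1 3] mono[of 0 4] by simp_all
  have b: "\<bar>c * w\<bar> \<le> \<bar>c\<bar> * r^4" if "\<bar>w\<bar> \<le> r^4" for c w
    unfolding abs_mult by (rule mult_left_mono[OF that]) simp
  show ?thesis
    unfolding distrib_right by (intro order_trans[OF abs_triangle_ineq] add_mono b m order_refl)
qed

text \<open>
  In the frame the field is \<open>x' = y \<ell> - d y z\<close>, \<open>y' = a x z - x \<ell>\<close> with \<open>\<ell> = e x + f y\<close>.
  The Lyapunov function is a quartic correction of \<open>a x\<^sup>2 + d y\<^sup>2\<close>: the cubic terms cancel the cubic part
  of the derivative, and the quartic terms make its quartic part definite with the sign of
  \<open>B = 6 (a - d) e f (a + d)\<close>, which plays the role of the first Lyapunov constant.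
\<close>

theorem center_imp_reducible:
  assumes frame: "right_frame u1 u2 u3" and eigen: "M *v u3 = \<kappa> *\<^sub>R u3"
    and diag: "u1 \<bullet> (M *v u2) = 0" "u2 \<bullet> (M *v u1) = 0"
    and a: "a = u1 \<bullet> (M *v u1) - \<kappa>" and d: "d = u2 \<bullet> (M *v u2) - \<kappa>"
    and e: "e = u3 \<bullet> (M *v u1)" and g: "g = u3 \<bullet> (M *v u2)"
    and ad: "a * d > 0" and center: "center (quadratic_field M) u3"
  shows "e = 0 \<or> g = 0 \<or> a = d"
proof (rule ccontr)
  assume "\<not> ?thesis"
  then have nz: "e \<noteq> 0" "g \<noteq> 0" "a \<noteq> d" by auto
  note fr = right_frame_inner[OF frame]
  have a0: "a \<noteq> 0" and d0: "d \<noteq> 0" using ad by auto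
  have "a + d \<noteq> 0" using ad by (auto simp: zero_less_mult_iff)
  define K where "K = a - d"
  define B where "B = 6 * K * e * g * (a + d)"
  have B0: "B \<noteq> 0" using nz \<open>a + d \<noteq> 0\<close> by (simp add: B_def K_def)
  define s where "s = a\<^sup>2 + d\<^sup>2"
  have s: "s > 0" using a0 by (simp add: s_def sum_power2_gt_zero_iff)
  define \<tau> where "\<tau> = a * d / (6 * s)"
  have \<tau>: "\<tau> > 0" using ad s by (simp add: \<tau>_def)
  \<comment> \<open>The quadratic part of \<open>W\<close> is constant along the linearised
    rotation, so its full derivative is the cubic \<open>6 * a * d * K * (x * y) * l x y\<close>.
    The constants \<open>c3\<close> and \<open>c4\<close> cancel it at \<open>z = 1\<close>; the
    factor \<open>3 * a * d\<close> in \<open>W\<close> clears their denominators.\<close>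
  define c3 where "c3 = 2 * a * K * e"
  define c4 where "c4 = - 2 * d * K * g"
  \<comment> \<open>\<open>q0\<close> and \<open>q4\<close> are determined by removing
    \<open>x^3 * y\<close> and \<open>x * y^3\<close> from the quartic part of the
    derivative.\<close>
  define q0 where "q0 = 3 * K * a * e\<^sup>2 / (2 * d)"
  define q4 where "q4 = - 3 * K * d * g\<^sup>2 / (2 * a)"
  \<comment> \<open>\<open>q1\<close> and \<open>q3\<close> trade half of
    \<open>B * x\<^sup>2 * y\<^sup>2\<close> for equal multiples \<open>B * \<tau>\<close> of
    \<open>x^4\<close> and \<open>y^4\<close>, turning a semidefinite form into a definite
    one.\<close>
  define q1 where "q1 = B * d / (6 * s)"
  define q3 where "q3 = - B * a / (6 * s)"
  define W where "W x y = 3 * a * d * (a * x\<^sup>2 + d * y\<^sup>2) + c3 * x^3 + c4 * y^3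
    + (q0 * x^4 + q1 * (x^3 * y) + q3 * (x * y^3) + q4 * y^4)" for x y :: real
  define l where "l x y = e * x + g * y" for x y
  define H where "H x y = (a * q1) * x^4 + (- 4 * d * q0) * (x^3 * y) + (3 * a * q3 - 3 * d * q1) * (x\<^sup>2 * y\<^sup>2)
    + (4 * a * q4) * (x * y^3) + (- d * q3) * y^4" for x y :: real
  define G where "G x y = (- q1) * x^4 + (4 * q0) * (x^3 * y) + (3 * q1 - 3 * q3) * (x\<^sup>2 * y\<^sup>2)
    + (- 4 * q4) * (x * y^3) + q3 * y^4" for x y :: real
  \<comment> \<open>The error has order 5 against a leading form of order 4: \<open>1 - z\<close>
    has order 2 near the singularity and multiplies terms of order at least 3, while
    \<open>l * G\<close> has order 5.\<close>
  define E where "E x y z = (1 - z) * (6 * a * d * K * (x * y) * l x y - H x y) + l x y * G x y" for x y z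
  have rel: "- 4 * d * q0 = - (6 * a * K * e\<^sup>2)" "4 * a * q4 = - (6 * d * K * g\<^sup>2)"
    "a * q1 = B * \<tau>" "- d * q3 = B * \<tau>"
    using a0 d0 by (simp_all add: q0_def q4_def q1_def q3_def \<tau>_def)
  have rel5: "3 * a * q3 - 3 * d * q1 = - (B / 2)"
  proof -
    have m: "q1 * (6 * s) = B * d" "q3 * (6 * s) = - (B * a)" using s by (simp_all add: q1_def q3_def)
    have "(3 * a * q3 - 3 * d * q1) * (6 * s) = 3 * a * (q3 * (6 * s)) - 3 * d * (q1 * (6 * s))"
      by (simp only: left_diff_distrib mult.assoc)
    also have "\<dots> = - (B / 2) * (6 * s)" unfolding m by (simp add: s_def power2_eq_square algebra_simps)
    finally show ?thesis using s by (simp only: mult_cancel_right) simp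
  qed
  have leading: "l x y * (3 * c3 * (x\<^sup>2 * y) - 3 * c4 * (x * y\<^sup>2)) + H x y
      = B * (\<tau> * x^4 + x\<^sup>2 * y\<^sup>2 / 2 + \<tau> * y^4)" for x y
  proof -
    have "H x y = (B * \<tau>) * x^4 + (- (6 * a * K * e\<^sup>2)) * (x^3 * y) + (- (B / 2)) * (x\<^sup>2 * y\<^sup>2)
        + (- (6 * d * K * g\<^sup>2)) * (x * y^3) + (B * \<tau>) * y^4"
      unfolding H_def rel rel5 ..
    moreover have "l x y * (3 * c3 * (x\<^sup>2 * y) - 3 * c4 * (x * y\<^sup>2))
        = 6 * a * K * e\<^sup>2 * (x^3 * y) + B * (x\<^sup>2 * y\<^sup>2) + 6 * d * K * g\<^sup>2 * (x * y^3)"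
      by (simp add: l_def c3_def c4_def B_def power2_eq_square power3_eq_cube algebra_simps)
    ultimately show ?thesis by (simp add: algebra_simps)
  qed

  \<comment> \<open>Since \<open>a * d > 0\<close>, the quadratic part of \<open>W\<close> is
    definite with the sign of \<open>a\<close>; the factor \<open>a\<close> makes \<open>V\<close>
    positive.\<close>
  define V where "V v = a * W (u1 \<bullet> v) (u2 \<bullet> v)" for v
  define V' where "V' v = a * (B * (\<tau> * (u1 \<bullet> v)^4 + (u1 \<bullet> v)\<^sup>2 * (u2 \<bullet> v)\<^sup>2 / 2 + \<tau> * (u2 \<bullet> v)^4)
    + E (u1 \<bullet> v) (u2 \<bullet> v) (u3 \<bullet> v))" for v
  have X: "u1 \<bullet> quadratic_field M v = (u2 \<bullet> v) * l (u1 \<bullet> v) (u2 \<bullet> v) - d * (u2 \<bullet> v) * (u3 \<bullet> v)"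
    "u2 \<bullet> quadratic_field M v = a * (u1 \<bullet> v) * (u3 \<bullet> v) - (u1 \<bullet> v) * l (u1 \<bullet> v) (u2 \<bullet> v)" for v
    by (simp_all add: quadratic_field_coords[OF frame] right_frame_matrix[OF frame, of _ M v] eigen fr diag
        a d e g l_def algebra_simps)
  have deriv: "((\<lambda>t. V (\<gamma> t)) has_real_derivative V' (\<gamma> t)) (at t)"
    if "(\<gamma> has_vector_derivative quadratic_field M (\<gamma> t)) (at t)" for \<gamma> t
  proof -
    define x where "x = u1 \<bullet> \<gamma> t"
    define y where "y = u2 \<bullet> \<gamma> t"
    define z where "z = u3 \<bullet> \<gamma> t"
    define L where "L = l x y"
    define J where "J = 6 * a * d * K * (x * y) * L"
    define cubic where "cubic = 3 * c3 * x\<^sup>2 * (y * L - d * y * z) + 3 * c4 * y\<^sup>2 * (a * x * z - x * L)"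
    define quartic where "quartic = (4 * q0 * x^3 + 3 * q1 * x\<^sup>2 * y + q3 * y^3) * (y * L - d * y * z)
        + (q1 * x^3 + 3 * q3 * x * y\<^sup>2 + 4 * q4 * y^3) * (a * x * z - x * L)"
    have quadratic: "6 * a * d * (a * x * (y * L - d * y * z) + d * y * (a * x * z - x * L)) = J"
      by (simp add: J_def K_def algebra_simps)
    have "cubic = L * (3 * c3 * (x\<^sup>2 * y) - 3 * c4 * (x * y\<^sup>2)) - z * (3 * c3 * d * (x\<^sup>2 * y) - 3 * c4 * a * (x * y\<^sup>2))"
      by (simp add: cubic_def algebra_simps power2_eq_square)
    also have "3 * c3 * d * (x\<^sup>2 * y) - 3 * c4 * a * (x * y\<^sup>2) = J"
      by (simp add: c3_def c4_def J_def L_def l_def power2_eq_square algebra_simps)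
    finally have cubic: "cubic = L * (3 * c3 * (x\<^sup>2 * y) - 3 * c4 * (x * y\<^sup>2)) - z * J" .
    have quartic: "quartic = z * H x y + L * G x y"
      by (simp add: quartic_def H_def G_def power2_eq_square power3_eq_cube power4_eq_xxxx algebra_simps)
    have "V' (\<gamma> t) = a * (L * (3 * c3 * (x\<^sup>2 * y) - 3 * c4 * (x * y\<^sup>2)) + H x y + E x y z)"
      unfolding L_def leading V'_def x_def y_def z_def ..
    also have "E x y z = (1 - z) * (J - H x y) + L * G x y"
      unfolding E_def J_def L_def ..
    finally have V'_eq: "V' (\<gamma> t) = a * (J + cubic + quartic)"
      unfolding cubic quartic by (simp only: left_diff_distrib right_diff_distrib mult_1_left) simp
    have dx: "((\<lambda>t. u1 \<bullet> \<gamma> t) has_real_derivative y * L - d * y * z) (at t)"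
      and dy: "((\<lambda>t. u2 \<bullet> \<gamma> t) has_real_derivative a * x * z - x * L) (at t)"
      using has_real_derivative_inner_right[OF that, of u1] has_real_derivative_inner_right[OF that, of u2]
      by (simp_all add: X x_def y_def z_def L_def)
    show ?thesis
      unfolding V_def W_def V'_eq quadratic[symmetric] cubic_def quartic_def
      by (rule derivative_eq_intros dx dy refl)+
        (simp only: flip: x_def y_def, simp add: power2_eq_square power3_eq_cube algebra_simps)
  qed

  \<comment> \<open>Local estimates near the singularity\<close>
  define CH where "CH = \<bar>a * q1\<bar> + \<bar>- 4 * d * q0\<bar> + \<bar>3 * a * q3 - 3 * d * q1\<bar> + \<bar>4 * a * q4\<bar> + \<bar>- d * q3\<bar>"
  define CQ where "CQ = \<bar>q0\<bar> + \<bar>q1\<bar> + \<bar>0\<bar> + \<bar>q3\<bar> + \<bar>q4\<bar>"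
  define CA where "CA = 6 * \<bar>a * d * K\<bar> * (\<bar>e\<bar> + \<bar>g\<bar>)
    + CH"
  define CG where "CG = \<bar>- q1\<bar> + \<bar>4 * q0\<bar> + \<bar>3 * q1 - 3 * q3\<bar> + \<bar>- 4 * q4\<bar> + \<bar>q3\<bar>"
  define C where "C = CA + (\<bar>e\<bar> + \<bar>g\<bar>) * CG"
  define C2 where "C2 = \<bar>a\<bar> * (\<bar>c3\<bar> + \<bar>c4\<bar> + CQ)"
  have C_nonneg: "CA \<ge> 0" "CG \<ge> 0" "C \<ge> 0" "C2 \<ge> 0"
    by (simp_all add: CA_def CG_def C_def C2_def CH_def CQ_def)
  have "CH \<ge> 0" "CQ \<ge> 0" by (simp_all add: CH_def CQ_def)
  define k1 where "k1 = \<bar>B\<bar> * \<tau> / 2"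
  define k2 where "k2 = 3 * min (a * a * (a * d)) ((a * d) * (a * d))"
  have "a * a > 0" using a0 not_real_square_gt_zero[of a] by blast
  then have sq: "a * a * (a * d) > 0" "(a * d) * (a * d) > 0" using mult_pos_pos ad by blast+
  have k1: "k1 > 0" unfolding k1_def by (intro divide_pos_pos mult_pos_pos \<tau>) (use B0 in auto)
  have k2: "k2 > 0" using sq unfolding k2_def min_def by (simp split: if_split)
  \<comment> \<open>The bound 1/2 keeps \<open>z\<close> positive, so that
    \<open>1 - z \<le> r\<^sup>2\<close>. The others make the remainders, at most
    \<open>C * r^5\<close> and \<open>C2 * r^3\<close>, smaller than the definite parts, at least
    \<open>k1 * r^4\<close> and \<open>k2 * r\<^sup>2\<close>.\<close>
  define \<rho> where "\<rho> = min (1/2) (min (k1 / (C + 1)) (k2 / (C2 + 1)))"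
  have "k1 / (C + 1) > 0" by (rule divide_pos_pos[OF k1]) (use C_nonneg in linarith)
  moreover have "k2 / (C2 + 1) > 0" by (rule divide_pos_pos[OF k2]) (use C_nonneg in linarith)
  ultimately have \<rho>: "\<rho> > 0" "\<rho> \<le> 1/2" "\<rho> \<le> k1 / (C + 1)" "\<rho> \<le> k2 / (C2 + 1)"
    unfolding \<rho>_def by linarith+

  have local: "V v > 0 \<and> \<bar>E (u1 \<bullet> v) (u2 \<bullet> v) (u3 \<bullet> v)\<bar>
      < \<bar>B\<bar> * (\<tau> * (u1 \<bullet> v)^4 + (u1 \<bullet> v)\<^sup>2 * (u2 \<bullet> v)\<^sup>2 / 2 + \<tau> * (u2 \<bullet> v)^4)"
    if v: "v \<in> S2" "v \<noteq> u3" "dist v u3 \<le> \<rho>" for v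
  proof -
    define x where "x = u1 \<bullet> v"
    define y where "y = u2 \<bullet> v"
    define z where "z = u3 \<bullet> v"
    define r where "r = sqrt (x\<^sup>2 + y\<^sup>2)"
    have r2: "r\<^sup>2 = x\<^sup>2 + y\<^sup>2" by (simp add: r_def)
    have "r \<ge> 0" by (simp add: r_def)
    have xr: "\<bar>x\<bar> \<le> r" and yr: "\<bar>y\<bar> \<le> r" by (simp_all add: r_def real_le_rsqrt)
    have sphere: "x\<^sup>2 + y\<^sup>2 + z\<^sup>2 = 1"
      using right_frame_inner_sum[OF frame, of v v] v(1)
      by (simp add: x_def y_def z_def power2_eq_square norm_eq_1)
    have "(v - u3) \<bullet> (v - u3) = x\<^sup>2 + y\<^sup>2 + (z - 1)\<^sup>2"
      unfolding right_frame_inner_sum[OF frame, of "v - u3"]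
      by (simp add: x_def y_def z_def inner_diff_right fr power2_eq_square)
    then have dist: "(dist v u3)\<^sup>2 = x\<^sup>2 + y\<^sup>2 + (z - 1)\<^sup>2"
      by (simp add: dist_norm power2_norm_eq_inner)
    have dist_le: "(dist v u3)\<^sup>2 \<le> \<rho>\<^sup>2" using v(3) by (intro power_mono) auto
    have "r \<le> \<rho>"
      using dist dist_le r2 \<rho>(1) by (intro power2_le_imp_le[of r \<rho>]) (simp_all, smt (verit) zero_le_power2)
    have "\<rho>\<^sup>2 \<le> (1/2)\<^sup>2" using \<rho> by (intro power_mono) auto
    then have "z > 0" using dist dist_le sphere by (simp add: power2_eq_square algebra_simps)
    have "z \<le> 1" using sphere by (smt (verit) power2_eq_square mult_le_cancel_left1 zero_le_power2 one_le_power power_one power2_le_imp_le)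
    have "(1 - z) * (1 + z) = r\<^sup>2" using sphere r2 by (simp add: power2_eq_square algebra_simps)
    moreover have "(1 - z) * 1 \<le> (1 - z) * (1 + z)"
      using \<open>z > 0\<close> \<open>z \<le> 1\<close> by (intro mult_left_mono) auto
    ultimately have zr: "0 \<le> 1 - z" "1 - z \<le> r\<^sup>2" using \<open>z \<le> 1\<close> by simp_all
    have "r \<noteq> 0"
    proof
      assume "r = 0"
      then have "x = 0" "y = 0" using r2 by (simp_all add: sum_power2_eq_zero_iff)
      then have "z = 1" using sphere \<open>z > 0\<close> by (simp add: power2_eq_1_iff)
      then have "v = u3"
        using \<open>x = 0\<close> \<open>y = 0\<close> by (intro right_frame_eqI[OF frame]) (simp_all add: x_def y_def z_def fr)
      then show False using v(2) by simp
    qed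
    then have "r > 0" using \<open>r \<ge> 0\<close> by simp
    have "r \<le> 1" using \<open>r \<le> \<rho>\<close> \<rho>(2) by simp
    have r_small: "C * r < k1" "C2 * r < k2"
    proof -
      have "r \<le> k1 / (C + 1)" "r \<le> k2 / (C2 + 1)" using \<open>r \<le> \<rho>\<close> \<rho>(3,4) by linarith+
      moreover have "C + 1 > 0" "C2 + 1 > 0" using C_nonneg by linarith+
      ultimately have "r * (C + 1) \<le> k1" "r * (C2 + 1) \<le> k2"
        using pos_le_divide_eq by blast+
      then show "C * r < k1" "C2 * r < k2"
        using \<open>r > 0\<close> unfolding distrib_left mult.commute[of r C] mult.commute[of r C2] by linarith+
    qed
    have l: "\<bar>l x y\<bar> \<le> (\<bar>e\<bar> + \<bar>g\<bar>) * r"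
    proof -
      have "\<bar>l x y\<bar> \<le> \<bar>e\<bar> * \<bar>x\<bar> + \<bar>g\<bar> * \<bar>y\<bar>"
        unfolding l_def abs_mult[symmetric] by (rule abs_triangle_ineq)
      also have "\<dots> \<le> \<bar>e\<bar> * r + \<bar>g\<bar> * r" by (intro add_mono mult_left_mono xr yr) auto
      finally show ?thesis by (simp add: algebra_simps)
    qed
    have r43: "r^4 \<le> r^3" using \<open>r > 0\<close> \<open>r \<le> 1\<close> by (simp add: power_decreasing)
    have "\<bar>H x y\<bar> \<le> CH * r^4"
      unfolding H_def CH_def by (rule quartic_form_bound[OF xr yr])
    also have "\<dots> \<le> CH * r^3"
      by (rule mult_left_mono[OF r43 \<open>CH \<ge> 0\<close>])
    finally have H: "\<bar>H x y\<bar> \<le> CH * r^3" .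
    have "\<bar>6 * a * d * K * (x * y) * l x y\<bar> = 6 * \<bar>a * d * K\<bar> * (\<bar>x\<bar> * \<bar>y\<bar>) * \<bar>l x y\<bar>"
      by (simp add: abs_mult)
    also have "\<dots> \<le> 6 * \<bar>a * d * K\<bar> * (r * r) * ((\<bar>e\<bar> + \<bar>g\<bar>) * r)"
      using \<open>r > 0\<close> by (intro mult_mono mult_left_mono xr yr l) auto
    also have "\<dots> = 6 * \<bar>a * d * K\<bar> * (\<bar>e\<bar> + \<bar>g\<bar>) * r^3" by (simp add: power3_eq_cube mult_ac)
    finally have "\<bar>6 * a * d * K * (x * y) * l x y\<bar> \<le> 6 * \<bar>a * d * K\<bar> * (\<bar>e\<bar> + \<bar>g\<bar>) * r^3" .
    from order_trans[OF abs_triangle_ineq4 add_mono[OF this H]]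
    have "\<bar>6 * a * d * K * (x * y) * l x y - H x y\<bar> \<le> CA * r^3"
      unfolding CA_def by (simp only: distrib_right)
    then have E1: "\<bar>(1 - z) * (6 * a * d * K * (x * y) * l x y - H x y)\<bar> \<le> r\<^sup>2 * (CA * r^3)"
      unfolding abs_mult using zr by (intro mult_mono) auto
    have "\<bar>G x y\<bar> \<le> CG * r^4"
      unfolding G_def CG_def by (rule quartic_form_bound[OF xr yr])
    then have E2: "\<bar>l x y * G x y\<bar> \<le> ((\<bar>e\<bar> + \<bar>g\<bar>) * r) * (CG * r^4)"
      unfolding abs_mult using l \<open>r > 0\<close> by (intro mult_mono) auto
    have "\<bar>E x y z\<bar> \<le> r\<^sup>2 * (CA * r^3) + ((\<bar>e\<bar> + \<bar>g\<bar>) * r) * (CG * r^4)"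
      unfolding E_def by (rule order_trans[OF abs_triangle_ineq add_mono[OF E1 E2]])
    also have "\<dots> = (C * r) * r^4"
      by (simp add: C_def power2_eq_square power3_eq_cube power4_eq_xxxx algebra_simps)
    also have "\<dots> < k1 * r^4" using r_small \<open>r > 0\<close> by (intro mult_strict_right_mono) auto
    also have "\<dots> \<le> \<bar>B\<bar> * (\<tau> * x^4 + x\<^sup>2 * y\<^sup>2 / 2 + \<tau> * y^4)"
    proof -
      have "r^4 = (x\<^sup>2 + y\<^sup>2)\<^sup>2" unfolding r2[symmetric] by simp
      also have "\<dots> = 2 * (x^4 + y^4) - (x\<^sup>2 - y\<^sup>2)\<^sup>2"
        by (simp add: power2_eq_square power4_eq_xxxx algebra_simps)
      also have "\<dots> \<le> 2 * (x^4 + y^4)" by simp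
      finally have "r^4 / 2 \<le> x^4 + y^4" by simp
      then have "\<tau> * (r^4 / 2) \<le> \<tau> * (x^4 + y^4)" using \<tau> by (intro mult_left_mono) auto
      also have "\<dots> \<le> \<tau> * x^4 + x\<^sup>2 * y\<^sup>2 / 2 + \<tau> * y^4" by (simp add: distrib_left)
      finally have "\<bar>B\<bar> * (\<tau> * (r^4 / 2)) \<le> \<bar>B\<bar> * (\<tau> * x^4 + x\<^sup>2 * y\<^sup>2 / 2 + \<tau> * y^4)"
        by (rule mult_left_mono) simp
      then show ?thesis by (simp add: k1_def)
    qed
    finally have E: "\<bar>E x y z\<bar> < \<bar>B\<bar> * (\<tau> * x^4 + x\<^sup>2 * y\<^sup>2 / 2 + \<tau> * y^4)" .

    have cube: "\<bar>w\<bar>^3 \<le> r^3" if "\<bar>w\<bar> \<le> r" for w using that by (intro power_mono) auto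
    have q: "\<bar>q0 * x^4 + q1 * (x^3 * y) + q3 * (x * y^3) + q4 * y^4\<bar>
        \<le> CQ * r^3"
    proof -
      have "\<bar>q0 * x^4 + q1 * (x^3 * y) + q3 * (x * y^3) + q4 * y^4\<bar>
          \<le> CQ * r^4"
        using quartic_form_bound[OF xr yr, of q0 q1 0 q3 q4] unfolding CQ_def by simp
      also have "\<dots> \<le> CQ * r^3" by (rule mult_left_mono[OF r43 \<open>CQ \<ge> 0\<close>])
      finally show ?thesis .
    qed
    define rest where "rest = c3 * x^3 + c4 * y^3 + (q0 * x^4 + q1 * (x^3 * y) + q3 * (x * y^3) + q4 * y^4)"
    have b: "\<bar>c * w^3\<bar> \<le> \<bar>c\<bar> * r^3" if "\<bar>w\<bar> \<le> r" for c w
      unfolding abs_mult power_abs by (rule mult_left_mono[OF cube[OF that]]) simp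
    have "\<bar>rest\<bar> \<le> (\<bar>c3\<bar> + \<bar>c4\<bar> + CQ) * r^3"
      unfolding rest_def distrib_right by (intro order_trans[OF abs_triangle_ineq] add_mono b xr yr q)
    then have "\<bar>a * rest\<bar> \<le> C2 * r^3"
      unfolding abs_mult C2_def mult.assoc by (rule mult_left_mono) simp
    also have "\<dots> = (C2 * r) * r\<^sup>2" by (simp add: power2_eq_square power3_eq_cube)
    also have "\<dots> < k2 * r\<^sup>2" using r_small \<open>r > 0\<close> by (intro mult_strict_right_mono) auto
    also have "\<dots> \<le> 3 * (a * a * (a * d)) * x\<^sup>2 + 3 * ((a * d) * (a * d)) * y\<^sup>2"
      unfolding r2 distrib_left by (intro add_mono mult_right_mono) (simp_all add: k2_def)
    finally have "0 < 3 * (a * a * (a * d)) * x\<^sup>2 + 3 * ((a * d) * (a * d)) * y\<^sup>2 + a * rest" by linarith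
    also have "\<dots> = V v"
      unfolding V_def W_def rest_def x_def y_def by (simp add: algebra_simps power2_eq_square)
    finally show ?thesis using E by (simp add: x_def y_def z_def)
  qed

  \<comment> \<open>Near the singularity \<open>V'\<close> has the sign of \<open>a * B\<close>;
    \<open>\<sigma>\<close> selects the direction of time in which \<open>V\<close>
    decreases.\<close>
  define \<sigma> where "\<sigma> = - sgn (a * B)"
  have "\<not> center (quadratic_field M) u3"
  proof (rule strict_lyapunov_not_center[of \<rho> V u3 "quadratic_field M" V' \<sigma>])
    show "\<rho> > 0" by (rule \<rho>)
    show "V v > 0" if "v \<in> S2" "v \<noteq> u3" "dist v u3 \<le> \<rho>" for v using local[OF that] by blast
    show "((\<lambda>t. V (\<gamma> t)) has_real_derivative V' (\<gamma> t)) (at t)"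
      if "(\<gamma> has_vector_derivative quadratic_field M (\<gamma> t)) (at t)" for \<gamma> t by (rule deriv[OF that])
    show "continuous_on UNIV V"
      unfolding V_def W_def by (intro continuous_intros)
    show "V u3 = 0" by (simp add: V_def W_def fr)
    show "\<sigma> = 1 \<or> \<sigma> = - 1" using a0 B0 by (auto simp: \<sigma>_def sgn_if)
    fix v assume v: "v \<in> S2" "v \<noteq> u3" "dist v u3 \<le> \<rho>"
    define F where "F = \<tau> * (u1 \<bullet> v)^4 + (u1 \<bullet> v)\<^sup>2 * (u2 \<bullet> v)\<^sup>2 / 2 + \<tau> * (u2 \<bullet> v)^4"
    define E0 where "E0 = E (u1 \<bullet> v) (u2 \<bullet> v) (u3 \<bullet> v)"
    have E0: "\<bar>E0\<bar> < \<bar>B\<bar> * F" using local[OF v] by (simp add: E0_def F_def)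
    have "V' v = a * (B * F + E0)" by (simp add: V'_def F_def E0_def)
    then have eq: "sgn (a * B) * V' v = (sgn a * a) * ((sgn B * B) * F + sgn B * E0)"
      by (simp add: sgn_mult algebra_simps)
    have "\<bar>sgn B * E0\<bar> = \<bar>E0\<bar>" using B0 by (simp add: abs_mult abs_sgn_eq)
    then have "0 < \<bar>B\<bar> * F + sgn B * E0" using E0 by linarith
    then have "0 < \<bar>a\<bar> * (\<bar>B\<bar> * F + sgn B * E0)" by (intro mult_pos_pos) (use a0 in auto)
    then have "0 < sgn (a * B) * V' v" unfolding eq abs_sgn by (simp only: mult.commute)
    then show "\<sigma> * V' v < 0" unfolding \<sigma>_def by simp
  qed
  then show False using center by blast
qed

subsection \<open>The linear part at a singularity\<close>

text \<open>Multiplying the eigenvalue equation by the adjugate of \<open>A - \<mu>\<close> yields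
  \<open>p\<close> times \<open>w\<close>, and \<open>w\<close> has a nonzero entry.\<close>

lemma complex_eigenvalue_char_poly:
  assumes "complex_eigenvalue A \<mu>"
  shows "\<mu>\<^sup>2 - of_real (trace A) * \<mu> + of_real (det A) = 0"
proof -
  obtain w :: "complex^2" where w: "w \<noteq> 0" and Aw: "map_matrix complex_of_real A *v w = \<mu> *s w"
    using assms by (auto simp: complex_eigenvalue_def)
  have eqs: "of_real (A$1$1) * w$1 + of_real (A$1$2) * w$2 = \<mu> * w$1"
    "of_real (A$2$1) * w$1 + of_real (A$2$2) * w$2 = \<mu> * w$2"
    using Aw by (simp_all add: vec_eq_iff forall_2 matrix_vector_mult_def sum_2 map_matrix_def)
  define p where "p = \<mu>\<^sup>2 - of_real (trace A) * \<mu> + of_real (det A)"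
  have p: "p = (of_real (A$1$1) - \<mu>) * (of_real (A$2$2) - \<mu>) - of_real (A$1$2) * of_real (A$2$1)"
    by (simp add: p_def trace_def sum_2 det_2 power2_eq_square algebra_simps)
  have "p * w$1 = 0" "p * w$2 = 0" unfolding p using eqs by algebra+
  moreover have "w$1 \<noteq> 0 \<or> w$2 \<noteq> 0" using w by (simp add: vec_eq_iff forall_2)
  ultimately show ?thesis by (auto simp: p_def)
qed

text \<open>For a purely imaginary root the real part of the characteristic equation gives
  \<open>det A = (Im \<mu>)\<^sup>2\<close> and the imaginary part gives
  \<open>trace A * Im \<mu> = 0\<close>.\<close>

lemma not_hyperbolic_cases:
  assumes "singularity X p" "\<not> hyperbolic X p"
  shows "det (linear_part_matrix X p) = 0
    \<or> trace (linear_part_matrix X p) = 0 \<and> det (linear_part_matrix X p) > 0"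
proof -
  define A where "A = linear_part_matrix X p"
  obtain \<mu> where \<mu>: "complex_eigenvalue A \<mu>" "Re \<mu> = 0"
    using assms by (auto simp: hyperbolic_def A_def)
  have *: "\<mu>\<^sup>2 - of_real (trace A) * \<mu> + of_real (det A) = 0"
    by (rule complex_eigenvalue_char_poly[OF \<mu>(1)])
  have "det A = (Im \<mu>)\<^sup>2" "trace A * Im \<mu> = 0"
    using arg_cong[OF *, of Re] arg_cong[OF *, of Im] \<mu>(2) by (simp_all add: power2_eq_square)
  then show ?thesis unfolding A_def[symmetric] by (cases "Im \<mu> = 0") auto
qed

lemma quadratic_field_derivative:
  "frechet_derivative (quadratic_field M) (at p) = (\<lambda>w. w \<times> (M *v p) + p \<times> (M *v w))"
proof (rule frechet_derivative_at[symmetric])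
  have bb: "bounded_bilinear (\<times>)" using bilinear_cross by (simp add: bilinear_conv_bounded_bilinear)
  have "((\<lambda>v. v \<times> (M *v v)) has_derivative (\<lambda>w. p \<times> (M *v w) + w \<times> (M *v p))) (at p)"
    by (rule bounded_bilinear.FDERIV[OF bb has_derivative_ident
          bounded_linear_imp_has_derivative[OF matrix_vector_mul_bounded_linear]])
  then show "(quadratic_field M has_derivative (\<lambda>w. w \<times> (M *v p) + p \<times> (M *v w))) (at p)"
    by (simp add: quadratic_field_def[abs_def] add.commute)
qed

lemma singularity_eigenvector:
  assumes "singularity (quadratic_field M) p"
  shows "M *v p = (p \<bullet> (M *v p)) *\<^sub>R p"
proof -
  have pp: "p \<bullet> p = 1" and X: "p \<times> (M *v p) = 0"
    using assms by (auto simp: singularity_def quadratic_field_def norm_eq_1)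
  have "p \<times> (p \<times> (M *v p)) = (p \<bullet> (M *v p)) *\<^sub>R p - (p \<bullet> p) *\<^sub>R (M *v p)"
    by (rule Lagrange)
  then show ?thesis by (simp add: X pp)
qed

text \<open>The linear part is \<open>w \<mapsto> p \<times> (M w - \<kappa> w)\<close>, so its
  trace measures the asymmetry of \<open>N\<close> and its determinant is that of \<open>N\<close>.
  The frame chosen in the definition has unknown orientation; swapping its two vectors corrects this
  and changes neither invariant.\<close>

lemma singularity_adapted_frame:
  assumes "singularity (quadratic_field M) p"
  obtains u1 u2 where "right_frame u1 u2 p"
    "trace (linear_part_matrix (quadratic_field M) p) = u1 \<bullet> (M *v u2) - u2 \<bullet> (M *v u1)"
    "det (linear_part_matrix (quadratic_field M) p) =
      (u1 \<bullet> (M *v u1) - p \<bullet> (M *v p)) * (u2 \<bullet> (M *v u2) - p \<bullet> (M *v p)) - (u1 \<bullet> (M *v u2)) * (u2 \<bullet> (M *v u1))"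
proof -
  have p: "p \<in> S2" "p \<bullet> p = 1" using assms by (auto simp: singularity_def norm_eq_1)
  define \<kappa> where "\<kappa> = p \<bullet> (M *v p)"
  have eigen: "M *v p = \<kappa> *\<^sub>R p" unfolding \<kappa>_def by (rule singularity_eigenvector[OF assms])
  define e where "e = (SOME e. orthonormal_frame p e)"
  have e: "orthonormal_frame p e"
    unfolding e_def by (rule someI_ex[OF orthonormal_frame_exists[OF p(1)]])
  then have ee: "e$1 \<bullet> e$1 = 1" "e$2 \<bullet> e$2 = 1" "e$1 \<bullet> e$2 = 0" "e$2 \<bullet> e$1 = 0" "e$1 \<bullet> p = 0" "e$2 \<bullet> p = 0"
    "p \<bullet> e$1 = 0" "p \<bullet> e$2 = 0"
    by (auto simp: orthonormal_frame_def tangent_space_def inner_commute)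
  define A where "A = linear_part_matrix (quadratic_field M) p"
  have A: "A $ i $ j = e$i \<bullet> (\<kappa> *\<^sub>R (e$j \<times> p) + p \<times> (M *v e$j))" for i j
    by (simp add: A_def linear_part_matrix_def frame_matrix_def e_def[symmetric] quadratic_field_derivative
        eigen cross_mult_right)
  have entries: "u1 \<bullet> (\<kappa> *\<^sub>R (w \<times> p) + p \<times> (M *v w)) = \<kappa> * (u2 \<bullet> w) - u2 \<bullet> (M *v w)"
    "u2 \<bullet> (\<kappa> *\<^sub>R (w \<times> p) + p \<times> (M *v w)) = - \<kappa> * (u1 \<bullet> w) + u1 \<bullet> (M *v w)"
    if frame: "right_frame u1 u2 p" for u1 u2 w
    by (simp_all add: right_frame_cross[OF frame] right_frame_inner[OF frame] inner_add_right)
  have "(norm (e$1 \<times> e$2))\<^sup>2 = 1"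
    using norm_cross_dot[of "e$1" "e$2"] ee by (simp add: norm_eq_1[symmetric])
  then have ncross: "(e$1 \<times> e$2) \<bullet> (e$1 \<times> e$2) = 1" by (simp add: power2_norm_eq_inner)
  have frame0: "right_frame (e$1) (e$2) (e$1 \<times> e$2)" using ee by (simp add: right_frame_def)
  define r where "r = (e$1 \<times> e$2) \<bullet> p"
  have p_eq: "r *\<^sub>R (e$1 \<times> e$2) = p"
    using right_frame_expand[OF frame0, of p] ee by (simp add: r_def)
  have "(r *\<^sub>R (e$1 \<times> e$2)) \<bullet> (r *\<^sub>R (e$1 \<times> e$2)) = 1" unfolding p_eq by (rule p(2))
  then have "r\<^sup>2 = 1" by (simp add: ncross power2_eq_square)
  then consider "r = 1" | "r = -1" by (auto simp: power2_eq_1_iff)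
  then consider "p = e$1 \<times> e$2" | "p = e$2 \<times> e$1"
    using p_eq cross_skew[of "e$1" "e$2"] by cases auto
  then show ?thesis
  proof cases
    case 1
    then have frame: "right_frame (e$1) (e$2) p" using ee by (simp add: right_frame_def)
    show ?thesis
      using that[OF frame]
      unfolding A_def[symmetric] \<kappa>_def[symmetric] trace_def det_2 sum_2 A entries[OF frame]
      by (simp add: ee algebra_simps)
  next
    case 2
    then have frame: "right_frame (e$2) (e$1) p" using ee by (simp add: right_frame_def)
    show ?thesis
      using that[OF frame]
      unfolding A_def[symmetric] \<kappa>_def[symmetric] trace_def det_2 sum_2 A entries[OF frame]
      by (simp add: ee algebra_simps)
  qed
qed

section \<open>Planar linear algebra and the final case distinction\<close>

lemma unit_orthogonal_pair:
  fixes a b :: real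
  obtains c s where "c\<^sup>2 + s\<^sup>2 = 1" "a * c + b * s = 0"
proof (cases "a = 0 \<and> b = 0")
  case True
  then show ?thesis using that[of 1 0] by simp
next
  case False
  define n where "n = sqrt (a\<^sup>2 + b\<^sup>2)"
  have "a\<^sup>2 + b\<^sup>2 > 0" using False by (simp add: sum_power2_gt_zero_iff)
  then have "n\<^sup>2 = a\<^sup>2 + b\<^sup>2" "n > 0" by (simp_all add: n_def)
  then have "(b / n)\<^sup>2 + (- a / n)\<^sup>2 = 1"
    using \<open>a\<^sup>2 + b\<^sup>2 > 0\<close> False by (auto simp: power_divide simp flip: add_divide_distrib)
  then show ?thesis using that[of "b / n" "- a / n"] by (simp add: algebra_simps)
qed

lemma singular_2x2_kernel:
  fixes n11 n12 n21 n22 :: real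
  assumes "n11 * n22 = n12 * n21"
  obtains c s where "c\<^sup>2 + s\<^sup>2 = 1" "n11 * c + n12 * s = 0" "n21 * c + n22 * s = 0"
proof (cases "n11 = 0 \<and> n12 = 0")
  case True
  then show ?thesis using unit_orthogonal_pair[of n21 n22] that by auto
next
  case False
  obtain c s where cs: "c\<^sup>2 + s\<^sup>2 = 1" "n11 * c + n12 * s = 0" by (rule unit_orthogonal_pair)
  have "n11 * (n21 * c + n22 * s) = n21 * (n11 * c + n12 * s) + s * (n11 * n22 - n12 * n21)"
    "n12 * (n21 * c + n22 * s) = n22 * (n11 * c + n12 * s) - c * (n11 * n22 - n12 * n21)"
    by (simp_all add: algebra_simps)
  then have "n21 * c + n22 * s = 0" using False cs(2) assms by auto
  then show ?thesis using that cs by blast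
qed

theorem corollary6:
  fixes X :: "real^3 \<Rightarrow> real^3"
  assumes "homogeneous_vf_on_S2 2 X"
    and "\<exists>p. singularity X p \<and> \<not> hyperbolic X p \<and> \<not> weak_focus X p"
  shows "\<not> (\<exists>C. limit_cycle X C)"
proof -
  obtain M where X: "X = quadratic_field M" using quadratic_field_exists[OF assms(1)] by blast
  obtain p where sing: "singularity X p" and "\<not> hyperbolic X p" "\<not> weak_focus X p"
    using assms(2) by blast
  define \<kappa> where "\<kappa> = p \<bullet> (M *v p)"
  have eigen: "M *v p = \<kappa> *\<^sub>R p"
    unfolding \<kappa>_def by (rule singularity_eigenvector) (use sing X in simp)
  obtain u1 u2 where frame: "right_frame u1 u2 p"
    and tr: "trace (linear_part_matrix X p) = u1 \<bullet> (M *v u2) - u2 \<bullet> (M *v u1)"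
    and det: "det (linear_part_matrix X p) =
      (u1 \<bullet> (M *v u1) - \<kappa>) * (u2 \<bullet> (M *v u2) - \<kappa>) - (u1 \<bullet> (M *v u2)) * (u2 \<bullet> (M *v u1))"
    unfolding X \<kappa>_def by (rule singularity_adapted_frame) (use sing X in auto)
  note f = right_frame_inner[OF frame]
  note expand = matrix_vector_right_distrib matrix_vector_mult_diff_distrib matrix_vector_mult_scaleR
    inner_add_left inner_add_right inner_diff_left inner_diff_right
  consider "det (linear_part_matrix X p) = 0" | "trace (linear_part_matrix X p) = 0" "det (linear_part_matrix X p) > 0"
    using not_hyperbolic_cases[OF sing \<open>\<not> hyperbolic X p\<close>] by blast
  then show ?thesis
  proof cases
    case 1
    \<comment> \<open>The frame is rotated so that its first vector spans a kernel direction of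
      \<open>N\<close>.\<close>
    obtain c s where cs: "c\<^sup>2 + s\<^sup>2 = 1"
      and ker: "(u1 \<bullet> (M *v u1) - \<kappa>) * c + (u1 \<bullet> (M *v u2)) * s = 0"
        "(u2 \<bullet> (M *v u1)) * c + (u2 \<bullet> (M *v u2) - \<kappa>) * s = 0"
      by (rule singular_2x2_kernel[of "u1 \<bullet> (M *v u1) - \<kappa>" "u2 \<bullet> (M *v u2) - \<kappa>"
            "u1 \<bullet> (M *v u2)" "u2 \<bullet> (M *v u1)"]) (use 1 det in auto)
    define w1 where "w1 = c *\<^sub>R u1 + s *\<^sub>R u2"
    define w2 where "w2 = c *\<^sub>R u2 - s *\<^sub>R u1"
    have frame': "right_frame w1 w2 p" unfolding w1_def w2_def by (rule right_frame_rotate[OF frame cs])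
    have "u1 \<bullet> (M *v w1) = \<kappa> * c" "u2 \<bullet> (M *v w1) = \<kappa> * s"
      using ker by (simp_all add: w1_def expand algebra_simps)
    then have "w1 \<bullet> (M *v w1) = \<kappa> * (c\<^sup>2 + s\<^sup>2)" "w2 \<bullet> (M *v w1) = 0"
      by (simp_all add: w1_def[THEN arg_cong, of "\<lambda>w. w \<bullet> x" for x] w2_def inner_add_left inner_diff_left
          power2_eq_square algebra_simps)
    then show ?thesis
      using degenerate_singularity_no_limit_cycle[OF frame' eigen] cs X by simp
  next
    case 2
    then have "center X p" using sing \<open>\<not> weak_focus X p\<close> by (auto simp: weak_focus_def)
    define \<beta> where "\<beta> = u1 \<bullet> (M *v u2)"
    have sym: "u2 \<bullet> (M *v u1) = \<beta>" using 2(1) tr by (simp add: \<beta>_def)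
    define n1 where "n1 = u1 \<bullet> (M *v u1) - \<kappa>"
    define n2 where "n2 = u2 \<bullet> (M *v u2) - \<kappa>"
    have N: "u1 \<bullet> (M *v u1) = n1 + \<kappa>" "u2 \<bullet> (M *v u2) = n2 + \<kappa>" "u1 \<bullet> (M *v u2) = \<beta>"
      by (simp_all add: n1_def n2_def \<beta>_def)
    obtain c s where cs: "c\<^sup>2 + s\<^sup>2 = 1" and off: "(c\<^sup>2 - s\<^sup>2) * \<beta> + c * s * (n2 - n1) = 0"
      by (rule symmetric_form_diagonalizable) blast
    define w1 where "w1 = c *\<^sub>R u1 + s *\<^sub>R u2"
    define w2 where "w2 = c *\<^sub>R u2 - s *\<^sub>R u1"
    have frame': "right_frame w1 w2 p" unfolding w1_def w2_def by (rule right_frame_rotate[OF frame cs])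
    note f' = right_frame_inner[OF frame']
    define a where "a = w1 \<bullet> (M *v w1) - \<kappa>"
    define d where "d = w2 \<bullet> (M *v w2) - \<kappa>"
    define e where "e = p \<bullet> (M *v w1)"
    define g where "g = p \<bullet> (M *v w2)"
    have "w1 \<bullet> (M *v w2) = (c\<^sup>2 - s\<^sup>2) * \<beta> + c * s * (n2 - n1)"
      "w2 \<bullet> (M *v w1) = (c\<^sup>2 - s\<^sup>2) * \<beta> + c * s * (n2 - n1)"
      by (simp_all add: w1_def w2_def expand N sym power2_eq_square algebra_simps)
    then have diag: "w1 \<bullet> (M *v w2) = 0" "w2 \<bullet> (M *v w1) = 0" using off by simp_all
    have "w1 \<bullet> (M *v w1) = c\<^sup>2 * n1 + 2 * c * s * \<beta> + s\<^sup>2 * n2 + \<kappa> * (c\<^sup>2 + s\<^sup>2)"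
      "w2 \<bullet> (M *v w2) = s\<^sup>2 * n1 - 2 * c * s * \<beta> + c\<^sup>2 * n2 + \<kappa> * (c\<^sup>2 + s\<^sup>2)"
      by (simp_all add: w1_def w2_def expand N sym power2_eq_square algebra_simps)
    then have ad_eq: "a = c\<^sup>2 * n1 + 2 * c * s * \<beta> + s\<^sup>2 * n2" "d = s\<^sup>2 * n1 - 2 * c * s * \<beta> + c\<^sup>2 * n2"
      by (simp_all add: a_def d_def cs)
    \<comment> \<open>Rotation invariance of the determinant of \<open>N\<close>; in principal axes
      the off-diagonal term drops out.\<close>
    have "a * d - ((c\<^sup>2 - s\<^sup>2) * \<beta> + c * s * (n2 - n1))\<^sup>2 = (c\<^sup>2 + s\<^sup>2)\<^sup>2 * (n1 * n2 - \<beta> * \<beta>)"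
      unfolding ad_eq by (simp add: power2_eq_square algebra_simps)
    then have "a * d = n1 * n2 - \<beta> * \<beta>" unfolding off cs by simp
    then have ad: "a * d > 0" using 2(2) det by (simp add: N sym)
    have "e = 0 \<or> g = 0 \<or> a = d"
      by (rule center_imp_reducible[OF frame' eigen diag a_def d_def e_def g_def ad])
        (use \<open>center X p\<close> X in simp)
    moreover have Mw: "M *v w1 = (a + \<kappa>) *\<^sub>R w1 + e *\<^sub>R p" "M *v w2 = (d + \<kappa>) *\<^sub>R w2 + g *\<^sub>R p"
      by (rule right_frame_eqI[OF frame']; simp add: inner_add_right f' diag a_def d_def e_def g_def)+
    moreover have left: "w1 \<bullet> (M *v v) = (a + \<kappa>) * (w1 \<bullet> v)" "w2 \<bullet> (M *v v) = (d + \<kappa>) * (w2 \<bullet> v)" for v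
      by (simp_all add: right_frame_matrix[OF frame', of _ M v] diag eigen f' a_def d_def)
    have norms: "norm w1 = 1" "norm w2 = 1" using f' by (simp_all add: norm_eq_1)
    consider "e = 0" | "g = 0" | "a = d" using calculation by blast
    then show ?thesis
    proof cases
      case 1
      then show ?thesis
        using eigenplane_no_limit_cycle[OF norms(1) _ left(1)] Mw(1) X by simp
    next
      case 2
      then show ?thesis
        using eigenplane_no_limit_cycle[OF norms(2) _ left(2)] Mw(2) X by simp
    next
      case 3
      \<comment> \<open>For \<open>a = d\<close> every vector orthogonal to \<open>p\<close> is a
        left eigenvector. The one with coordinates orthogonal to \<open>(e, g)\<close> is also a
        right eigenvector, since its image has no extra component along \<open>p\<close>.\<close>
      obtain c' s' where cs': "c'\<^sup>2 + s'\<^sup>2 = 1" "e * c' + g * s' = 0" by (rule unit_orthogonal_pair)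
      define k where "k = c' *\<^sub>R w1 + s' *\<^sub>R w2"
      have "norm k = 1"
        using cs'(1) by (simp add: norm_eq_1 k_def inner_add_left inner_add_right f' power2_eq_square)
      moreover have "M *v k = (a + \<kappa>) *\<^sub>R k + (e * c' + g * s') *\<^sub>R p"
        by (simp add: k_def matrix_vector_right_distrib matrix_vector_mult_scaleR Mw 3 algebra_simps)
      then have "M *v k = (a + \<kappa>) *\<^sub>R k" by (simp add: cs'(2))
      moreover have "k \<bullet> (M *v v) = (a + \<kappa>) * (k \<bullet> v)" for v
        by (simp add: k_def inner_add_left left 3 algebra_simps)
      ultimately show ?thesis
        using eigenplane_no_limit_cycle X by blast
    qed
  qed
qed

end
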